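(* Let $\mathcal{C}(\mathcal{I})$ be a decreasing monomial code and $r=\max_{f\in \mathcal{I}}\deg(f)$. Then any codeword of weight $1.5\,\mathrm{w}_{\min}$, say $\operatorname{ev}(P)$, is such that there exist $f,g\in \mathcal{I}_r$ with $$P\in{\rm LTA}(m,2)_h\cdot h\cdot\Big({\rm LTA}(m,2)_{f} \cdot \tfrac{f}{h}+{\rm LTA}(m,2)_{g}\cdot \tfrac{g}{h}\Big),$$ where $h=\gcd(f,g)$ and $\deg(h)=r-2$.
   Context: Work in $\mathbf{R}_m=\mathbb{F}_2[x_0,\dots,x_{m-1}]/(x_i^2-x_i)$; $\operatorname{ev}(P)\in\mathbb{F}_2^{2^m}$ is the evaluation of $P$ at all points of $\mathbb{F}_2^m$, and $\mathrm{w}(\cdot)$ denotes Hamming weight. For a monomial set $\mathcal{I}$, $\mathcal{C}(\mathcal{I})=\operatorname{span}\{\operatorname{ev}(f): f\in\mathcal{I}\}$ and $\mathcal{I}_r=\{f\in\mathcal{I}:\deg f=r\}$. The partial order $\preceq$ on monomials: $f\preceq g$ iff there is $g^*$ with $f\preceq_{sh} g^*$ and $g^*\mid g$, where for $f=x_{i_1}\cdots x_{i_s}$, $g^*=x_{j_1}\cdots x_{j_s}$ (indices increasing), $f\preceq_{sh}g^*$ means $i_\ell\le j_\ell$ for all $\ell$. $\mathcal{I}$ is decreasing if $f\in\mathcal{I}$ and $g\preceq f$ imply $g\in\mathcal{I}$. The minimum weight of $\mathcal{C}(\mathcal{I})$ is $\mathrm{w}_{\min}=2^{m-r}$. ${\rm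 LTA}(m,2)$ is the group of affine maps $\mathbf{x}\mapsto \mathbf{B}\mathbf{x}+\boldsymbol{\varepsilon}$ with $\mathbf{B}$ lower triangular with unit diagonal, acting on monomials by replacing $x_i$ with $x_i+\sum_{j<i}b_{i,j}x_j+\varepsilon_i$. For a monomial $g$, ${\rm LTA}(m,2)_g$ is the subgroup with $\varepsilon_i=0$ for $i\notin\operatorname{ind}(g)$, and $b_{i,j}=0$ whenever $i\notin\operatorname{ind}(g)$ or $j\in\operatorname{ind}(g)$ ($\operatorname{ind}(g)$ = set of indices of variables of $g$). For a group $G$ and monomial $f$, $G\cdot f$ is the orbit; for polynomial sets, $\mathcal{S}+\mathcal{T}=\{s+t\}$ (Minkowski sum) and $\mathcal{S}\cdot\mathcal{T}=\{st\}$. *)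

theory Defs
  imports Main
begin

text \<open>Elements of R_m = F_2[x_0..x_{m-1}]/(x_i^2 - x_i) are represented by their
  (unique) multilinear normal form: a finite set of monomials, where a monomial is the
  set of indices of its variables (the monomial 1 is the empty set).\<close>

type_synonym mono = "nat set"
type_synonym bpoly = "nat set set"

definition Rm :: "nat \<Rightarrow> bpoly set" where
  "Rm m = {P. P \<subseteq> Pow {..<m}}"

definition padd :: "bpoly \<Rightarrow> bpoly \<Rightarrow> bpoly" where
  "padd P Q = (P - Q) \<union> (Q - P)"

definition pmul :: "bpoly \<Rightarrow> bpoly \<Rightarrow> bpoly" where
  "pmul P Q = {S. odd (card {(A, B). A \<in> P \<and> B \<in> Q \<and> A \<union> B = S})}"

definition pone :: bpoly where "pone = {{}}"

definition pprod_list :: "bpoly list \<Rightarrow> bpoly" where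
  "pprod_list Ps = foldr pmul Ps pone"

text \<open>Evaluation at a point of F_2^m, the point given by its support X \<subseteq> {..<m}.\<close>
definition peval :: "bpoly \<Rightarrow> nat set \<Rightarrow> bool" where
  "peval P X = odd (card {S \<in> P. S \<subseteq> X})"

definition ev :: "nat \<Rightarrow> bpoly \<Rightarrow> nat set \<Rightarrow> bool" where
  "ev m P = (\<lambda>X. X \<subseteq> {..<m} \<and> peval P X)"

definition weight :: "nat \<Rightarrow> (nat set \<Rightarrow> bool) \<Rightarrow> nat" where
  "weight m c = card {X \<in> Pow {..<m}. c X}"

text \<open>C(I): F_2-span of the ev(f), f \<in> I (all F_2-linear combinations = sums over subsets).\<close>
definition code :: "nat \<Rightarrow> mono set \<Rightarrow> (nat set \<Rightarrow> bool) set" where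
  "code m I = {c. \<exists>J \<subseteq> I. c = (\<lambda>X. X \<subseteq> {..<m} \<and> odd (card {f \<in> J. ev m {f} X}))}"

definition sh_le :: "mono \<Rightarrow> mono \<Rightarrow> bool" where
  "sh_le f g \<longleftrightarrow> finite f \<and> finite g \<and> card f = card g \<and>
     (\<forall>l < card f. sorted_list_of_set f ! l \<le> sorted_list_of_set g ! l)"

definition mono_le :: "mono \<Rightarrow> mono \<Rightarrow> bool" where
  "mono_le f g \<longleftrightarrow> (\<exists>g'. sh_le f g' \<and> g' \<subseteq> g)"

definition decreasing :: "nat \<Rightarrow> mono set \<Rightarrow> bool" where
  "decreasing m I \<longleftrightarrow> I \<subseteq> Pow {..<m} \<and> (\<forall>f \<in> I. \<forall>g. mono_le g f \<longrightarrow> g \<in> I)"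

definition wmin :: "nat \<Rightarrow> nat \<Rightarrow> nat" where
  "wmin m r = 2 ^ (m - r)"

text \<open>Elements of LTA(m,2): B lower triangular unit-diagonal (entries b i j, j < i < m),
  translation eps (eps i only for i < m).\<close>
definition is_lta :: "nat \<Rightarrow> (nat \<Rightarrow> nat \<Rightarrow> bool) \<Rightarrow> (nat \<Rightarrow> bool) \<Rightarrow> bool" where
  "is_lta m b eps \<longleftrightarrow> (\<forall>i j. b i j \<longrightarrow> j < i \<and> i < m) \<and> (\<forall>i. eps i \<longrightarrow> i < m)"

definition is_lta_g :: "nat \<Rightarrow> mono \<Rightarrow> (nat \<Rightarrow> nat \<Rightarrow> bool) \<Rightarrow> (nat \<Rightarrow> bool) \<Rightarrow> bool" where
  "is_lta_g m g b eps \<longleftrightarrow> is_lta m b eps \<and> (\<forall>i. i \<notin> g \<longrightarrow> \<not> eps i) \<and>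
     (\<forall>i j. (i \<notin> g \<or> j \<in> g) \<longrightarrow> \<not> b i j)"

definition lin_img :: "(nat \<Rightarrow> nat \<Rightarrow> bool) \<Rightarrow> (nat \<Rightarrow> bool) \<Rightarrow> nat \<Rightarrow> bpoly" where
  "lin_img b eps i = {{i}} \<union> {{j} | j. j < i \<and> b i j} \<union> (if eps i then {{}} else {})"

definition act_mono :: "(nat \<Rightarrow> nat \<Rightarrow> bool) \<Rightarrow> (nat \<Rightarrow> bool) \<Rightarrow> mono \<Rightarrow> bpoly" where
  "act_mono b eps f = pprod_list (map (lin_img b eps) (sorted_list_of_set f))"

definition act_poly :: "(nat \<Rightarrow> nat \<Rightarrow> bool) \<Rightarrow> (nat \<Rightarrow> bool) \<Rightarrow> bpoly \<Rightarrow> bpoly" where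
  "act_poly b eps P = {S. odd (card {f \<in> P. S \<in> act_mono b eps f})}"

definition orbit_g :: "nat \<Rightarrow> mono \<Rightarrow> bpoly set \<Rightarrow> bpoly set" where
  "orbit_g m g S = {act_poly b eps P | b eps P. is_lta_g m g b eps \<and> P \<in> S}"

definition set_add :: "bpoly set \<Rightarrow> bpoly set \<Rightarrow> bpoly set" where
  "set_add S T = {padd s t | s t. s \<in> S \<and> t \<in> T}"

definition set_mul :: "bpoly set \<Rightarrow> bpoly set \<Rightarrow> bpoly set" where
  "set_mul S T = {pmul s t | s t. s \<in> S \<and> t \<in> T}"

end

theory Submission
  imports Defs
begin

text \<open>Identify a word with its support \<open>S\<close> in \<open>F_2^m\<close> and let \<open>d = 2^(m-r)\<close>. A derivative
  \<open>D_v S = S + (S + v)\<close> has degree at most \<open>r - 1\<close>, hence weight \<open>0\<close> or at least \<open>2d\<close>; this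
  yields by induction on \<open>r\<close> that words of weight \<open>d\<close> are flats and that no weight lies strictly
  between \<open>d\<close> and \<open>3d/2\<close>. If \<open>|S| = 3d/2\<close>, some derivative is a flat \<open>F\<close> of size \<open>2d\<close> that misses
  exactly \<open>d/2\<close> points \<open>A\<close> of \<open>S\<close>. These form a flat parallel to a subflat of \<open>F\<close>, so \<open>S\<close> lies in a
  flat \<open>T\<close> of codimension \<open>r - 2\<close>, on which it is \<open>l1 l2 + l3 l4\<close> with independent affine forms.
  Writing \<open>T\<close> in reduced echelon form gives the factor of \<open>h\<close>; a symplectic elimination on the
  \<open>l_i\<close> produces distinct leading variables. The leading monomial \<open>f\<close> of \<open>h l1 l2\<close> occurs in \<open>P\<close>, and
  the one of \<open>h l3 l4\<close> either occurs in \<open>P\<close> or is cancelled by a term of \<open>h l1 l2\<close>, in which case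
  it is below \<open>f\<close>.\<close>

subsection \<open>Degree and minimum weight\<close>

text \<open>Degree is defined through iterated derivatives, so it depends on the support alone and
  behaves well under sums and translations. Polynomials enter only at the two ends: to bound the
  degree of the support and to recover \<open>P\<close> from its values. The delicate point in
  between is that \<open>A\<close> must lie in a single translate of \<open>F\<close>; otherwise S
  would not fit into a flat of twice the size of \<open>F\<close>. Minimum weight decides this: a
  direction of \<open>A\<close> either leaves S invariant or has \<open>F\<close> itself as its
  derivative. The group dictates the normal form. A variable of f may be sent to itself plus smaller
  variables outside f, so \<alpha> and \<beta> must lead their own forms and be absent from each
  other's. They are also removed from l3 and l4, so that the coefficient of f cannot cancel and the
  gcd is h. The same is not asked of \<gamma> and \<delta> in l1 and l2: a transvection removing
  them would put \<alpha> or \<beta> back into the second pair. This is why g, unlike f, may be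
  missing from \<open>P\<close>.\<close>

definition sd :: "'a set \<Rightarrow> 'a set \<Rightarrow> 'a set" (infixl "\<triangle>" 65)
  where "A \<triangle> B = {x. (x \<in> A) \<noteq> (x \<in> B)}"

text \<open>Addition over F_2. The same operation adds points (sets of coordinates), words (sets of
  points) and polynomials (sets of monomials).\<close>

lemma in_sd [simp]: "x \<in> A \<triangle> B \<longleftrightarrow> (x \<in> A) \<noteq> (x \<in> B)"
  by (simp add: sd_def)

lemma sd_assoc: "(A \<triangle> B) \<triangle> C = A \<triangle> (B \<triangle> C)"
  and sd_commute: "A \<triangle> B = B \<triangle> A"
  and sd_left_commute: "A \<triangle> (B \<triangle> C) = B \<triangle> (A \<triangle> C)"
  and sd_self [simp]: "A \<triangle> A = {}"
  and sd_cancel [simp]: "A \<triangle> (A \<triangle> B) = B"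
  and sd_empty [simp]: "A \<triangle> {} = A" "{} \<triangle> A = A"
  by (auto simp: sd_def)

lemmas sd_ac = sd_assoc sd_commute sd_left_commute

lemma sd_eq_empty_iff [simp]: "A \<triangle> B = {} \<longleftrightarrow> A = B"
  by (auto simp: sd_def)

lemma sd_subset: "A \<subseteq> V \<Longrightarrow> B \<subseteq> V \<Longrightarrow> A \<triangle> B \<subseteq> V"
  by (auto simp: sd_def)

lemma finite_sd [simp]: "finite A \<Longrightarrow> finite B \<Longrightarrow> finite (A \<triangle> B)"
  by (rule finite_subset[of _ "A \<union> B"]) (auto simp: sd_def)

lemma card_sd:
  assumes "finite A" "finite B"
  shows "card (A \<triangle> B) + 2 * card (A \<inter> B) = card A + card B"
proof -
  have "A \<triangle> B = (A - B) \<union> (B - A)" by (auto simp: sd_def)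
  moreover have "(A - B) \<inter> (B - A) = {}" by auto
  ultimately have "card (A \<triangle> B) = card (A - B) + card (B - A)"
    using assms by (simp only: card_Un_disjoint finite_Diff)
  moreover have "card A = card (A - B) + card (A \<inter> B)"
    using assms by (metis card_Int_Diff add.commute)
  moreover have "card B = card (B - A) + card (A \<inter> B)"
    using assms by (metis card_Int_Diff add.commute Int_commute)
  ultimately show ?thesis by simp
qed

lemma even_card_sd:
  assumes "finite A" "finite B"
  shows "even (card (A \<triangle> B)) \<longleftrightarrow> (even (card A) \<longleftrightarrow> even (card B))"
  using card_sd[OF assms] by (metis even_add even_mult_iff even_numeral)

section \<open>Translations, derivatives and algebraic degree\<close>

definition shift :: "'a set \<Rightarrow> 'a set set \<Rightarrow> 'a set set"
  where "shift v S = (\<triangle>) v ` S"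

text \<open>Translation by v is an involution, so image and preimage coincide.\<close>

lemma in_shift [simp]: "x \<in> shift v S \<longleftrightarrow> v \<triangle> x \<in> S"
  unfolding shift_def by (metis image_iff sd_cancel)

lemma card_shift [simp]: "card (shift v S) = card S"
  unfolding shift_def by (rule card_image) (metis inj_onI sd_cancel)

lemma finite_shift [simp]: "finite S \<Longrightarrow> finite (shift v S)"
  by (simp add: shift_def)

lemma shift_sd: "shift v (S \<triangle> T) = shift v S \<triangle> shift v T"
  by auto

lemma shift_commute: "shift u (shift v S) = shift v (shift u S)"
  by (rule set_eqI) (simp only: in_shift sd_left_commute)

definition deriv :: "'a set \<Rightarrow> 'a set set \<Rightarrow> 'a set set"
  where "deriv v S = S \<triangle> shift v S"

lemma deriv_eq_empty_iff: "deriv v S = {} \<longleftrightarrow> shift v S = S"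
  unfolding deriv_def sd_eq_empty_iff by (rule eq_commute)

lemma card_deriv:
  assumes "finite S"
  shows "card (deriv v S) + 2 * card (S \<inter> shift v S) = 2 * card S"
  using card_sd[of S "shift v S"] assms by (simp add: deriv_def)

lemma shift_deriv: "shift v (deriv v S) = deriv v S"
  by (auto simp: deriv_def)

text \<open>Algebraic degree at most \<open>r\<close>, expressed by the vanishing of iterated derivatives.\<close>

primrec degle :: "nat \<Rightarrow> nat \<Rightarrow> nat set set \<Rightarrow> bool" where
  "degle m 0 S \<longleftrightarrow> S = {} \<or> S = Pow {..<m}"
| "degle m (Suc r) S \<longleftrightarrow> S \<subseteq> Pow {..<m} \<and> (\<forall>v \<subseteq> {..<m}. degle m r (deriv v S))"

declare degle.simps(2) [simp del]

lemma degle_deriv: "degle m (Suc r) S \<Longrightarrow> v \<subseteq> {..<m} \<Longrightarrow> degle m r (deriv v S)"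
  by (simp add: degle.simps(2))

lemma degle_SucI:
  "S \<subseteq> Pow {..<m} \<Longrightarrow> (\<And>v. v \<subseteq> {..<m} \<Longrightarrow> degle m r (deriv v S)) \<Longrightarrow> degle m (Suc r) S"
  by (simp add: degle.simps(2))

lemma degle_subset: "degle m r S \<Longrightarrow> S \<subseteq> Pow {..<m}"
  by (cases r) (auto simp: degle.simps(2))

lemma degle_finite: "degle m r S \<Longrightarrow> finite S"
  using degle_subset by (metis finite_Pow_iff finite_lessThan finite_subset)

lemma shift_Pow: "v \<subseteq> A \<Longrightarrow> shift v (Pow A) = Pow A"
  unfolding shift_def
proof (intro equalityI subsetI)
  fix x assume "v \<subseteq> A" "x \<in> Pow A"
  then have "x = v \<triangle> (v \<triangle> x)" "v \<triangle> x \<in> Pow A" using sd_subset by auto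
  then show "x \<in> (\<triangle>) v ` Pow A" by blast
qed (use sd_subset in auto)

lemma deriv_sd: "deriv v (S \<triangle> T) = deriv v S \<triangle> deriv v T"
  by (auto simp: deriv_def)

lemma degle_sd: "degle m r S \<Longrightarrow> degle m r T \<Longrightarrow> degle m r (S \<triangle> T)"
proof (induction r arbitrary: S T)
  case (Suc r)
  show ?case
  proof (rule degle_SucI)
    show "S \<triangle> T \<subseteq> Pow {..<m}" using Suc.prems[THEN degle_subset] by (rule sd_subset)
    show "degle m r (deriv v (S \<triangle> T))" if "v \<subseteq> {..<m}" for v
      unfolding deriv_sd using Suc.prems[THEN degle_deriv[OF _ that]] by (rule Suc.IH)
  qed
qed auto

lemma degle_empty: "degle m r {}"
proof (induction r)
  case (Suc r)
  have "deriv v {} = {}" for v :: "nat set" by (auto simp: deriv_def)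
  then show ?case using Suc by (simp add: degle_SucI)
qed simp

lemma degle_Suc: "degle m r S \<Longrightarrow> degle m (Suc r) S"
proof (induction r arbitrary: S)
  case 0
  have "deriv v S = {}" if "v \<subseteq> {..<m}" for v
    using 0 shift_Pow[OF that] by (auto simp: deriv_def shift_def)
  then show ?case using degle_subset[OF 0] by (simp add: degle_SucI)
next
  case (Suc r)
  show ?case
    by (intro degle_SucI[OF degle_subset[OF Suc.prems]] Suc.IH degle_deriv[OF Suc.prems])
qed

lemma degle_mono: "r \<le> s \<Longrightarrow> degle m r S \<Longrightarrow> degle m s S"
  by (induction s rule: dec_induct) (simp_all only: degle_Suc)

text \<open>The translate is \<open>S \<triangle> deriv v S\<close>, and the derivative has a
  smaller degree bound.\<close>

lemma degle_shift:
  assumes "degle m r S" "v \<subseteq> {..<m}"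
  shows "degle m r (shift v S)"
proof (cases r)
  case 0
  then show ?thesis using assms shift_Pow by (auto simp: shift_def)
next
  case (Suc s)
  have "degle m r (deriv v S)" using assms Suc degle_Suc degle_deriv by simp
  moreover have "shift v S = S \<triangle> deriv v S" by (simp add: deriv_def)
  ultimately show ?thesis using assms degle_sd by simp
qed

text \<open>The value at the point X of the affine form with variable set a and constant c. The set
  a may be empty, so constants are included.\<close>

definition aff :: "'a set \<Rightarrow> bool \<Rightarrow> 'a set \<Rightarrow> bool"
  where "aff a c X \<longleftrightarrow> odd (card (a \<inter> X)) \<noteq> c"

lemma even_card_Int_sd:
  "finite a \<Longrightarrow> even (card (a \<inter> (X \<triangle> Y))) \<longleftrightarrow> (even (card (a \<inter> X)) \<longleftrightarrow> even (card (a \<inter> Y)))"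
proof -
  assume "finite a"
  moreover have "a \<inter> (X \<triangle> Y) = (a \<inter> X) \<triangle> (a \<inter> Y)" by auto
  ultimately show ?thesis by (simp add: even_card_sd)
qed

lemma even_card_sd_Int:
  "finite a \<Longrightarrow> finite b \<Longrightarrow>
     even (card ((a \<triangle> b) \<inter> X)) \<longleftrightarrow> (even (card (a \<inter> X)) \<longleftrightarrow> even (card (b \<inter> X)))"
proof -
  assume "finite a" "finite b"
  moreover have "(a \<triangle> b) \<inter> X = (a \<inter> X) \<triangle> (b \<inter> X)" by auto
  ultimately show ?thesis by (simp add: even_card_sd)
qed

text \<open>Over F_2 a sum of three points is an affine combination: the constant occurs three times
  and survives once. Flats are therefore handled with three-term sums.\<close>

lemma aff_sd3:
  "finite a \<Longrightarrow> aff a c (X \<triangle> (Y \<triangle> Z)) \<longleftrightarrow> (aff a c X \<noteq> (aff a c Y \<noteq> aff a c Z))"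
  by (simp add: aff_def even_card_Int_sd) blast

text \<open>Product rule: the derivative of l S is l times the derivative of S, plus the derivative
  of l times the translate of S. The derivative of l is the constant parity of
  \<open>a \<inter> v\<close>, so both terms keep the degree bound of S.\<close>

lemma degle_aff:
  assumes "degle m r S" "finite a"
  shows "degle m (Suc r) {X \<in> S. aff a c X}"
  using assms(1)
proof (induction r arbitrary: S)
  case 0
  have "degle m 0 (deriv v {X \<in> S. aff a c X})" if v: "v \<subseteq> {..<m}" for v
  proof (cases "S = {}")
    case False
    then have S: "S = Pow {..<m}" using 0 by simp
    have "X \<in> deriv v {X \<in> S. aff a c X} \<longleftrightarrow> X \<in> Pow {..<m} \<and> odd (card (a \<inter> v))" for X
    proof -
      have "v \<triangle> X \<in> Pow {..<m} \<longleftrightarrow> X \<in> Pow {..<m}"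
        using shift_Pow[OF v] in_shift[of X v "Pow {..<m}"] by simp
      then show ?thesis unfolding S
        by (simp add: deriv_def aff_def even_card_Int_sd assms(2)) blast
    qed
    then show ?thesis by (cases "odd (card (a \<inter> v))") auto
  qed (auto simp: deriv_def)
  then show ?case using degle_subset[OF 0] by (intro degle_SucI) auto
next
  case (Suc r)
  have "degle m (Suc r) (deriv v {X \<in> S. aff a c X})" if v: "v \<subseteq> {..<m}" for v
  proof -
    have "deriv v {X \<in> S. aff a c X} =
      {X \<in> deriv v S. aff a c X} \<triangle> (if odd (card (a \<inter> v)) then shift v S else {})"
    proof (rule set_eqI)
      fix X
      show "X \<in> deriv v {X \<in> S. aff a c X} \<longleftrightarrow>
        X \<in> {X \<in> deriv v S. aff a c X} \<triangle> (if odd (card (a \<inter> v)) then shift v S else {})"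
        unfolding deriv_def in_sd mem_Collect_eq in_shift aff_def even_card_Int_sd[OF assms(2)]
        by simp blast
    qed
    moreover have "degle m (Suc r) {X \<in> deriv v S. aff a c X}"
      using Suc.IH[OF degle_deriv[OF Suc.prems v]] .
    moreover have "degle m (Suc r) (if odd (card (a \<inter> v)) then shift v S else {})"
      using degle_shift[OF Suc.prems v] degle_empty by simp
    ultimately show ?thesis by (simp only: degle_sd)
  qed
  moreover have "{X \<in> S. aff a c X} \<subseteq> Pow {..<m}" using degle_subset[OF Suc.prems] by auto
  ultimately show ?case by (rule degle_SucI[rotated])
qed

lemma degle_aff_all:
  assumes "finite h" "\<And>i. i \<in> h \<Longrightarrow> finite (a i)"
  shows "degle m (card h) {X \<in> Pow {..<m}. \<forall>i\<in>h. aff (a i) (c i) X}"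
  using assms
proof (induction h rule: finite_induct)
  case (insert i h)
  have "{X \<in> Pow {..<m}. \<forall>j\<in>insert i h. aff (a j) (c j) X} =
    {X \<in> {X \<in> Pow {..<m}. \<forall>j\<in>h. aff (a j) (c j) X}. aff (a i) (c i) X}" by auto
  moreover have "degle m (card h) {X \<in> Pow {..<m}. \<forall>j\<in>h. aff (a j) (c j) X}" "finite (a i)"
    using insert by auto
  ultimately have "degle m (Suc (card h)) {X \<in> Pow {..<m}. \<forall>j\<in>insert i h. aff (a j) (c j) X}"
    using degle_aff by (simp only:)
  then show ?case using insert(1,2) by (simp only: card_insert_disjoint not_False_eq_True)
qed (simp add: Pow_def)

text \<open>Minimum distance of the Reed-Muller code: a derivative at most doubles the weight and
  lowers the degree by one, and a nonempty word whose derivatives all vanish is invariant under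
  every translation. The product form avoids truncated subtraction for r > m.\<close>

lemma degle_weight:
  assumes "degle m r S" "S \<noteq> {}"
  shows "2 ^ m \<le> 2 ^ r * card S"
  using assms
proof (induction r arbitrary: S)
  case (Suc r)
  show ?case
  proof (cases "\<exists>v \<subseteq> {..<m}. deriv v S \<noteq> {}")
    case True
    then obtain v where v: "v \<subseteq> {..<m}" "deriv v S \<noteq> {}" by blast
    then have "2 ^ m \<le> 2 ^ r * card (deriv v S)" using Suc degle_deriv by blast
    also have "\<dots> \<le> 2 ^ r * (2 * card S)"
      using card_deriv[OF degle_finite[OF Suc.prems(1)], of v] by simp
    finally show ?thesis by simp
  next
    case False
    obtain x where x: "x \<in> S" using Suc by blast
    have "y \<in> S" if y: "y \<in> Pow {..<m}" for y
    proof -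
      have "x \<triangle> y \<subseteq> {..<m}"
        using y x degle_subset[OF Suc.prems(1)] by (intro sd_subset) auto
      then have "deriv (x \<triangle> y) S = {}" using False by metis
      then have "shift (x \<triangle> y) S = S" unfolding deriv_eq_empty_iff .
      moreover have "y \<in> shift (x \<triangle> y) S" using x by (simp add: sd_ac)
      ultimately show "y \<in> S" by (simp only:)
    qed
    then have "S = Pow {..<m}" using degle_subset[OF Suc.prems(1)] by blast
    then show ?thesis by (simp add: card_Pow)
  qed
qed (auto simp: card_Pow)

section \<open>Flats: affine subspaces over F_2\<close>

definition flat :: "'a set set \<Rightarrow> bool"
  where "flat F \<longleftrightarrow> F \<noteq> {} \<and> (\<forall>x\<in>F. \<forall>y\<in>F. \<forall>z\<in>F. x \<triangle> (y \<triangle> z) \<in> F)"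

lemma flatD: "flat F \<Longrightarrow> x \<in> F \<Longrightarrow> y \<in> F \<Longrightarrow> z \<in> F \<Longrightarrow> x \<triangle> (y \<triangle> z) \<in> F"
  by (simp add: flat_def)

lemma flatI_shift:
  assumes "S \<noteq> {}" "\<And>x y. x \<in> S \<Longrightarrow> y \<in> S \<Longrightarrow> shift (x \<triangle> y) S = S"
  shows "flat S"
  unfolding flat_def
proof (intro conjI ballI)
  fix x y z assume *: "x \<in> S" "y \<in> S" "z \<in> S"
  then have "x \<triangle> (y \<triangle> z) \<in> shift (x \<triangle> y) S" by (simp add: sd_ac)
  then show "x \<triangle> (y \<triangle> z) \<in> S" using assms * by blast
qed (use assms in auto)

text \<open>For x, y in S the point x lies in S and in its translate by x + y, so this derivative is
  lighter than 2|S|, the minimum weight in the next lower degree. Hence it vanishes, and S is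
  invariant under all its differences.\<close>

lemma degle_min_weight_flat:
  assumes "degle m r S" "2 ^ r * card S = 2 ^ m"
  shows "flat S"
proof (cases r)
  case 0
  have "card S \<noteq> 0" using assms by (metis mult_0_right power_not_zero zero_neq_numeral)
  then show ?thesis using 0 assms by (auto simp: flat_def)
next
  case (Suc s)
  have ne: "card S \<noteq> 0" using assms by (metis mult_0_right power_not_zero zero_neq_numeral)
  have fin: "finite S" using assms degle_finite by blast
  show ?thesis
  proof (rule flatI_shift)
    show "S \<noteq> {}" using ne by auto
    fix x y assume xy: "x \<in> S" "y \<in> S"
    then have v: "x \<triangle> y \<subseteq> {..<m}"
      using degle_subset[OF assms(1)] by (intro sd_subset) auto
    have "x \<in> S \<inter> shift (x \<triangle> y) S" using xy by (simp add: sd_ac)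
    then have "card (S \<inter> shift (x \<triangle> y) S) > 0" using fin by (metis card_gt_0_iff finite_Int empty_iff)
    then have lt: "card (deriv (x \<triangle> y) S) < 2 * card S" using card_deriv[OF fin, of "x \<triangle> y"] by linarith
    have "deriv (x \<triangle> y) S = {}"
    proof (rule ccontr)
      assume "deriv (x \<triangle> y) S \<noteq> {}"
      moreover have "degle m s (deriv (x \<triangle> y) S)" using assms Suc v degle_deriv by simp
      ultimately have "2 ^ m \<le> 2 ^ s * card (deriv (x \<triangle> y) S)" by (rule degle_weight[rotated])
      also have "\<dots> < 2 ^ s * (2 * card S)" using lt by simp
      finally show False using assms Suc by simp
    qed
    then show "shift (x \<triangle> y) S = S" by (simp add: deriv_eq_empty_iff)
  qed
qed

subsection \<open>Flats and half-spaces\<close>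

lemma aff_sd: "finite a \<Longrightarrow> finite b \<Longrightarrow> aff (a \<triangle> b) (c \<noteq> d) X \<longleftrightarrow> aff a c X \<noteq> aff b d X"
  by (simp add: aff_def even_card_sd_Int) blast

lemma aff_singleton: "aff {i} False X \<longleftrightarrow> i \<in> X"
  by (cases "i \<in> X") (simp_all add: aff_def)

lemma aff_Not: "aff a (\<not> c) X \<longleftrightarrow> \<not> aff a c X"
  by (auto simp: aff_def)

lemma aff_cong: "a \<inter> X = a \<inter> Y \<Longrightarrow> aff a c X \<longleftrightarrow> aff a c Y"
  by (simp add: aff_def)

text \<open>An affine function is determined by its values at the origin and at the unit points: the
  first is the constant, and k is a variable iff the value changes from {} to {k}.\<close>

lemma affine_function_aff:
  assumes "finite K"
    and \<phi>: "\<And>X Y Z. X \<subseteq> K \<Longrightarrow> Y \<subseteq> K \<Longrightarrow> Z \<subseteq> K \<Longrightarrow> \<phi> (X \<triangle> (Y \<triangle> Z)) \<longleftrightarrow> (\<phi> X \<noteq> (\<phi> Y \<noteq> \<phi> Z))"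
  obtains a c where "a \<subseteq> K" "\<And>X. X \<subseteq> K \<Longrightarrow> \<phi> X \<longleftrightarrow> aff a c X"
proof
  define a where "a = {k \<in> K. \<phi> {k} \<noteq> \<phi> {}}"
  show aK: "a \<subseteq> K" by (auto simp: a_def)
  have fin: "finite a" using aK assms(1) finite_subset by blast
  fix X assume X: "X \<subseteq> K"
  then have "finite X" using assms(1) finite_subset by blast
  then show "\<phi> X \<longleftrightarrow> aff a (\<phi> {}) X" using X
  proof (induction X rule: finite_induct)
    case empty
    show ?case by (simp add: aff_def)
  next
    case (insert x X)
    have ins: "insert x X = {x} \<triangle> (X \<triangle> {})" using insert by auto
    have "\<phi> (insert x X) \<longleftrightarrow> (\<phi> {x} \<noteq> (\<phi> X \<noteq> \<phi> {}))"
      unfolding ins using insert by (intro \<phi>) auto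
    moreover have "aff a (\<phi> {}) (insert x X) \<longleftrightarrow> (aff a (\<phi> {}) {x} \<noteq> (aff a (\<phi> {}) X \<noteq> aff a (\<phi> {}) {}))"
      unfolding ins by (rule aff_sd3[OF fin])
    moreover have "aff a (\<phi> {}) {x} \<longleftrightarrow> \<phi> {x}"
      using insert by (cases "x \<in> a") (auto simp: aff_def a_def)
    moreover have "aff a (\<phi> {}) {} \<longleftrightarrow> \<phi> {}" by (simp add: aff_def)
    ultimately show ?case using insert by simp
  qed
qed

text \<open>Reduced echelon form of an affine subspace: \<open>h\<close> is the set of pivots, which are
  expressed by non-pivots of smaller index.\<close>

definition echelon :: "nat \<Rightarrow> nat set \<Rightarrow> (nat \<Rightarrow> nat set) \<Rightarrow> bool"
  where "echelon m h L \<longleftrightarrow> h \<subseteq> {..<m} \<and> (\<forall>i\<in>h. L i \<subseteq> {..<i} - h)"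

definition ech :: "nat \<Rightarrow> nat set \<Rightarrow> (nat \<Rightarrow> nat set) \<Rightarrow> (nat \<Rightarrow> bool) \<Rightarrow> nat set set"
  where "ech m h L c = {X. X \<subseteq> {..<m} \<and> (\<forall>i\<in>h. i \<in> X \<longleftrightarrow> aff (L i) (c i) X)}"

text \<open>Fills in the pivots for given free coordinates Y; on the flat it inverts the deletion of
  h.\<close>

definition ext :: "nat set \<Rightarrow> (nat \<Rightarrow> nat set) \<Rightarrow> (nat \<Rightarrow> bool) \<Rightarrow> nat set \<Rightarrow> nat set"
  where "ext h L c Y = Y \<union> {i \<in> h. aff (L i) (c i) Y}"

lemma echelon_finite: "echelon m h L \<Longrightarrow> finite h" "echelon m h L \<Longrightarrow> i \<in> h \<Longrightarrow> finite (L i)"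
  unfolding echelon_def by (auto intro: finite_subset[of _ "{..<m}"] finite_subset[of _ "{..<i}"])

lemma echelonD:
  "echelon m h L \<Longrightarrow> i \<in> h \<Longrightarrow> i < m"
  "echelon m h L \<Longrightarrow> i \<in> h \<Longrightarrow> j \<in> L i \<Longrightarrow> j < i"
  "echelon m h L \<Longrightarrow> i \<in> h \<Longrightarrow> j \<in> L i \<Longrightarrow> j \<notin> h"
  "echelon m h L \<Longrightarrow> i \<in> h \<Longrightarrow> j \<in> L i \<Longrightarrow> j < m"
  unfolding echelon_def by fastforce+

lemma aff_echelon_Diff:
  assumes "echelon m h L" "i \<in> h"
  shows "aff (L i) c (X - h) \<longleftrightarrow> aff (L i) c X"
  using assms by (intro aff_cong) (auto simp: echelon_def)

lemma ext_Diff: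
  assumes "Y \<subseteq> {..<m} - h"
  shows "ext h L c Y - h = Y"
  using assms by (auto simp: ext_def)

lemma ext_in_ech:
  assumes "echelon m h L" "Y \<subseteq> {..<m} - h"
  shows "ext h L c Y \<in> ech m h L c"
proof -
  have "aff (L i) (c i) (ext h L c Y) \<longleftrightarrow> aff (L i) (c i) Y" if "i \<in> h" for i
    using aff_echelon_Diff[OF assms(1) that, of "c i" "ext h L c Y"] ext_Diff[OF assms(2)] by simp
  moreover have "ext h L c Y \<subseteq> {..<m}"
    using assms by (auto simp: ext_def echelon_def)
  ultimately show ?thesis using assms by (auto simp: ech_def ext_def)
qed

lemma ext_ech:
  assumes "echelon m h L" "X \<in> ech m h L c"
  shows "ext h L c (X - h) = X"
  using assms aff_echelon_Diff[OF assms(1)] by (auto simp: ext_def ech_def)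

lemma ech_inj:
  assumes "echelon m h L" "X \<in> ech m h L c" "Y \<in> ech m h L c" "X - h = Y - h"
  shows "X = Y"
  using assms ext_ech by metis

lemma ech_Diff_subset: "X \<in> ech m h L c \<Longrightarrow> X - h \<subseteq> {..<m} - h"
  by (auto simp: ech_def)

lemma bij_betw_ech:
  assumes "echelon m h L"
  shows "bij_betw (\<lambda>X. X - h) (ech m h L c) (Pow ({..<m} - h))"
  by (rule bij_betw_byWitness[where f' = "ext h L c"])
    (auto simp: ext_ech[OF assms] ext_Diff image_subset_iff
      intro: ext_in_ech[OF assms] dest: subsetD[OF ech_Diff_subset])

lemma card_ech:
  assumes "echelon m h L"
  shows "2 ^ card h * card (ech m h L c) = 2 ^ m"
proof -
  have h: "h \<subseteq> {..<m}" using assms by (simp add: echelon_def)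
  then have "card ({..<m} - h) = m - card h" "card h \<le> m"
    using card_mono[OF _ h] by (simp_all add: card_Diff_subset echelon_finite[OF assms])
  moreover have "card (ech m h L c) = 2 ^ card ({..<m} - h)"
    using bij_betw_same_card[OF bij_betw_ech[OF assms]] by (simp add: card_Pow)
  ultimately show ?thesis by (simp flip: power_add)
qed

text \<open>The pivot equation x_i = L_i + c_i says that x_i + L_i + c_i + 1 has the value 1, hence
  the negated constant.\<close>

lemma ech_eq_aff:
  assumes "echelon m h L"
  shows "ech m h L c = {X \<in> Pow {..<m}. \<forall>i\<in>h. aff ({i} \<triangle> L i) (\<not> c i) X}"
proof -
  have "aff ({i} \<triangle> L i) (\<not> c i) X \<longleftrightarrow> (i \<in> X \<longleftrightarrow> aff (L i) (c i) X)" if "i \<in> h" for i X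
    using aff_sd[of "{i}" "L i" False "\<not> c i" X] echelon_finite[OF assms] that
    by (simp add: aff_singleton aff_Not)
  then show ?thesis by (auto simp: ech_def)
qed

lemma degle_ech:
  assumes "echelon m h L"
  shows "degle m (card h) (ech m h L c)"
  unfolding ech_eq_aff[OF assms]
  by (rule degle_aff_all) (use echelon_finite[OF assms] in auto)

lemma ech_sd3:
  assumes "echelon m h L" "X \<in> ech m h L c" "Y \<in> ech m h L c" "Z \<in> ech m h L c"
  shows "X \<triangle> (Y \<triangle> Z) \<in> ech m h L c"
proof -
  have "X \<triangle> (Y \<triangle> Z) \<subseteq> {..<m}" using assms by (intro sd_subset) (auto simp: ech_def)
  moreover have "i \<in> X \<triangle> (Y \<triangle> Z) \<longleftrightarrow> aff (L i) (c i) (X \<triangle> (Y \<triangle> Z))" if "i \<in> h" for i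
    using assms that by (simp add: aff_sd3 echelon_finite(2)[OF assms(1)] ech_def)
  ultimately show ?thesis by (simp add: ech_def)
qed

lemma ext_sd3:
  assumes "echelon m h L" "X \<subseteq> {..<m} - h" "Y \<subseteq> {..<m} - h" "Z \<subseteq> {..<m} - h"
  shows "ext h L c (X \<triangle> (Y \<triangle> Z)) = ext h L c X \<triangle> (ext h L c Y \<triangle> ext h L c Z)"
proof (rule ech_inj[OF assms(1)])
  have XYZ: "X \<triangle> (Y \<triangle> Z) \<subseteq> {..<m} - h" using assms by (intro sd_subset)
  show "ext h L c (X \<triangle> (Y \<triangle> Z)) \<in> ech m h L c" using ext_in_ech[OF assms(1) XYZ] .
  show "ext h L c X \<triangle> (ext h L c Y \<triangle> ext h L c Z) \<in> ech m h L c"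
    by (intro ech_sd3[OF assms(1)] ext_in_ech[OF assms(1)] assms)
  have "(ext h L c X \<triangle> (ext h L c Y \<triangle> ext h L c Z)) - h =
      (ext h L c X - h) \<triangle> ((ext h L c Y - h) \<triangle> (ext h L c Z - h))" by auto
  then show "ext h L c (X \<triangle> (Y \<triangle> Z)) - h = (ext h L c X \<triangle> (ext h L c Y \<triangle> ext h L c Z)) - h"
    using assms by (simp add: ext_Diff[OF XYZ] ext_Diff)
qed

lemma Diff_singleton_eqD:
  assumes "X - {m} = Y - {m}"
  shows "X = Y \<or> X = {m} \<triangle> Y"
proof -
  have *: "z \<in> X \<longleftrightarrow> z \<in> Y" if "z \<noteq> m" for z using assms that by (metis Diff_iff singletonD)
  show ?thesis
  proof (cases "m \<in> X \<longleftrightarrow> m \<in> Y")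
    case True
    then show ?thesis using * by (metis set_eqI)
  next
    case False
    have "z \<in> X \<longleftrightarrow> z \<in> {m} \<triangle> Y" for z using * False by (cases "z = m") auto
    then show ?thesis by blast
  qed
qed

text \<open>Delete the largest coordinate m. If two points have the same projection, their sum is
  the direction {m}, and m is free. Otherwise m is an affine function of the free coordinates of the
  projection and becomes a pivot; being largest, it depends only on smaller indices and occurs in no
  earlier equation.\<close>

lemma flat_echelon:
  assumes "flat F" "F \<subseteq> Pow {..<m}"
  shows "\<exists>h L c. echelon m h L \<and> F = ech m h L c"
  using assms
proof (induction m arbitrary: F)
  case 0
  then have "F = {{}}" by (auto simp: flat_def)
  then have "echelon 0 {} L \<and> F = ech 0 {} L c" for L c
    by (auto simp: echelon_def ech_def)
  then show ?case by blast
next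
  case (Suc m)
  let ?p = "\<lambda>X. X - {m}"
  have pm: "?p X \<subseteq> {..<m}" if "X \<in> F" for X
    using that Suc.prems(2) by (fastforce simp: less_Suc_eq)
  have p3: "?p (X \<triangle> (Y \<triangle> Z)) = ?p X \<triangle> (?p Y \<triangle> ?p Z)" for X Y Z by auto
  have "flat (?p ` F)"
    unfolding flat_def
  proof (intro conjI ballI)
    show "?p ` F \<noteq> {}" using Suc.prems by (simp add: flat_def)
    fix x y z assume "x \<in> ?p ` F" "y \<in> ?p ` F" "z \<in> ?p ` F"
    then obtain X Y Z where "X \<in> F" "Y \<in> F" "Z \<in> F" "x = ?p X" "y = ?p Y" "z = ?p Z" by auto
    then show "x \<triangle> (y \<triangle> z) \<in> ?p ` F"
      using flatD[OF Suc.prems(1)] by (metis image_eqI p3)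
  qed
  moreover have "?p ` F \<subseteq> Pow {..<m}" using pm by blast
  ultimately obtain h L c where e: "echelon m h L" and pF: "?p ` F = ech m h L c"
    by (metis Suc.IH)
  have hm: "m \<notin> h" "\<And>i. i \<in> h \<Longrightarrow> m \<notin> L i" using echelonD[OF e] by blast+
  have p_ech: "?p X \<in> ech m h L c \<longleftrightarrow> X \<subseteq> {..<Suc m} \<and> (\<forall>i\<in>h. i \<in> X \<longleftrightarrow> aff (L i) (c i) X)" for X
  proof -
    have "aff (L i) (c i) (?p X) \<longleftrightarrow> aff (L i) (c i) X" if "i \<in> h" for i
      using hm that by (intro aff_cong) auto
    moreover have "?p X \<subseteq> {..<m} \<longleftrightarrow> X \<subseteq> {..<Suc m}" by (auto simp: less_Suc_eq)
    ultimately show ?thesis using hm by (auto simp: ech_def)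
  qed
  show ?case
  proof (cases "inj_on ?p F")
    case False
    then obtain X Y where XY: "X \<in> F" "Y \<in> F" "X \<noteq> Y" "?p X = ?p Y" by (auto simp: inj_on_def)
    then have m: "{m} \<triangle> Z = X \<triangle> (Y \<triangle> Z)" for Z
      using Diff_singleton_eqD[of X m Y] by (auto simp: sd_assoc sd_left_commute)
    have "Z \<in> F" if pZ: "?p Z \<in> ?p ` F" for Z
    proof -
      obtain W where W: "W \<in> F" "?p Z = ?p W" using pZ by blast
      have "{m} \<triangle> W \<in> F" unfolding m using flatD[OF Suc.prems(1) XY(1,2) W(1)] .
      then show ?thesis using Diff_singleton_eqD[OF W(2)] W(1) by metis
    qed
    then have "F = {Z. ?p Z \<in> ech m h L c}" using pF by auto
    then have "F = ech (Suc m) h L c" unfolding p_ech by (simp only: ech_def)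
    moreover have "echelon (Suc m) h L" using e by (auto simp: echelon_def)
    ultimately show ?thesis by blast
  next
    case True
    \<comment> \<open>The unique point of F whose projection has the free coordinates Y.\<close>
    define s where "s Y = inv_into F ?p (ext h L c Y)" for Y
    have s: "s Y \<in> F" "?p (s Y) = ext h L c Y" if "Y \<subseteq> {..<m} - h" for Y
    proof -
      have "ext h L c Y \<in> ?p ` F" unfolding pF using ext_in_ech[OF e that] .
      then show "s Y \<in> F" "?p (s Y) = ext h L c Y"
        unfolding s_def by (rule inv_into_into, rule f_inv_into_f)
    qed
    have "m \<in> s (X \<triangle> (Y \<triangle> Z)) \<longleftrightarrow> ((m \<in> s X) \<noteq> ((m \<in> s Y) \<noteq> (m \<in> s Z)))"
      if XYZ: "X \<subseteq> {..<m} - h" "Y \<subseteq> {..<m} - h" "Z \<subseteq> {..<m} - h" for X Y Z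
    proof -
      have *: "X \<triangle> (Y \<triangle> Z) \<subseteq> {..<m} - h" using XYZ by (intro sd_subset)
      have "s (X \<triangle> (Y \<triangle> Z)) = s X \<triangle> (s Y \<triangle> s Z)"
      proof (rule inj_onD[OF True])
        show "?p (s (X \<triangle> (Y \<triangle> Z))) = ?p (s X \<triangle> (s Y \<triangle> s Z))"
          unfolding p3 s(2)[OF *] using XYZ by (simp only: s(2) ext_sd3[OF e])
        show "s (X \<triangle> (Y \<triangle> Z)) \<in> F" using s(1)[OF *] .
        show "s X \<triangle> (s Y \<triangle> s Z) \<in> F" using s(1) XYZ flatD[OF Suc.prems(1)] by simp
      qed
      then show ?thesis by simp
    qed
    then obtain a d where a: "a \<subseteq> {..<m} - h" and ad: "\<And>Y. Y \<subseteq> {..<m} - h \<Longrightarrow> m \<in> s Y \<longleftrightarrow> aff a d Y"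
      using affine_function_aff[of "{..<m} - h" "\<lambda>Y. m \<in> s Y"] by (metis finite_Diff finite_lessThan)
    define h' where "h' = insert m h"
    define L' where "L' = L(m := a)"
    define c' where "c' = c(m := d)"
    have "echelon (Suc m) h' L'"
      using e a hm by (auto simp: echelon_def h'_def L'_def)
    moreover have "X \<in> F \<longleftrightarrow> X \<in> ech (Suc m) h' L' c'" for X
    proof -
      have "X \<in> ech (Suc m) h' L' c' \<longleftrightarrow> ?p X \<in> ech m h L c \<and> (m \<in> X \<longleftrightarrow> aff a d X)"
        unfolding p_ech using hm by (auto simp: ech_def h'_def L'_def c'_def)
      moreover have "X \<in> F \<longleftrightarrow> (m \<in> X \<longleftrightarrow> aff a d X)" if pX: "?p X \<in> ech m h L c"
      proof -
        let ?Y = "?p X - h"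
        have Y: "?Y \<subseteq> {..<m} - h" using ech_Diff_subset[OF pX] .
        have "aff a d ?Y \<longleftrightarrow> aff a d X" using a by (intro aff_cong) auto
        then have mY: "m \<in> s ?Y \<longleftrightarrow> aff a d X" using ad[OF Y] by simp
        have pY: "?p (s ?Y) = ?p X" using s(2)[OF Y] ext_ech[OF e pX] by simp
        show ?thesis
        proof
          assume "X \<in> F"
          then have "X = s ?Y" using inj_onD[OF True pY s(1)[OF Y]] by simp
          then show "m \<in> X \<longleftrightarrow> aff a d X" using mY by simp
        next
          assume "m \<in> X \<longleftrightarrow> aff a d X"
          then have "X = s ?Y" using mY pY by blast
          then show "X \<in> F" using s(1)[OF Y] by simp
        qed
      qed
      moreover have "?p X \<in> ech m h L c" if "X \<in> F" using that pF by blast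
      ultimately show ?thesis by blast
    qed
    ultimately show ?thesis by blast
  qed
qed

section \<open>Sizes of flats and cuts by half-spaces\<close>

lemma finite_family: "F \<subseteq> Pow {..<m::nat} \<Longrightarrow> finite F"
  by (rule finite_subset) auto

lemma flat_card_power2:
  assumes "flat F" "F \<subseteq> Pow {..<m}"
  obtains k where "2 ^ k * card F = 2 ^ m"
  using flat_echelon[OF assms] card_ech by blast

lemma degle_flat:
  assumes "flat F" "F \<subseteq> Pow {..<m}" "2 ^ k * card F = 2 ^ m"
  shows "degle m k F"
proof -
  obtain h L c where e: "echelon m h L" "F = ech m h L c" using flat_echelon assms by blast
  have "card F \<noteq> 0" using assms(3) by (metis mult_0_right power_not_zero zero_neq_numeral)
  moreover have "2 ^ card h * card F = 2 ^ k * card F" using card_ech[OF e(1)] e(2) assms(3) by simp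
  ultimately have "card h = k" by simp
  then show ?thesis using degle_ech[OF e(1)] e(2) by blast
qed

text \<open>A point outside F violates one of the pivot equations; that equation is the separating
  form.\<close>

lemma flat_separation:
  assumes "flat F" "F \<subseteq> Pow {..<m::nat}" "x \<subseteq> {..<m}" "x \<notin> F"
  obtains a c where "a \<subseteq> {..<m}" "\<And>X. X \<in> F \<Longrightarrow> aff a c X" "\<not> aff a c x"
proof -
  obtain h L c where e: "echelon m h L" and F: "F = ech m h L c" using flat_echelon assms by blast
  obtain i where i: "i \<in> h" "\<not> aff ({i} \<triangle> L i) (\<not> c i) x"
    using assms unfolding F ech_eq_aff[OF e] by blast
  moreover have "{i} \<triangle> L i \<subseteq> {..<m}" using echelonD[OF e i(1)] by (intro sd_subset) auto
  moreover have "aff ({i} \<triangle> L i) (\<not> c i) X" if "X \<in> F" for X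
    using i that unfolding F ech_eq_aff[OF e] by blast
  ultimately show ?thesis using that by blast
qed

lemma flat_Int: "flat F \<Longrightarrow> flat G \<Longrightarrow> F \<inter> G \<noteq> {} \<Longrightarrow> flat (F \<inter> G)"
  by (simp add: flat_def)

lemma flat_aff:
  assumes "flat F" "finite a" "p \<in> F" "aff a c p"
  shows "flat {X \<in> F. aff a c X}"
  using assms by (auto simp: flat_def aff_sd3)

text \<open>Translation by p + q preserves F and exchanges the two halves.\<close>

lemma card_flat_aff:
  assumes "flat F" "finite F" "finite a" "p \<in> F" "aff a c p" "q \<in> F" "\<not> aff a c q"
  shows "2 * card {X \<in> F. aff a c X} = card F"
proof -
  have "shift (p \<triangle> q) {X \<in> F. aff a c X} = {X \<in> F. \<not> aff a c X}"
  proof -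
    have "p \<triangle> (q \<triangle> X) \<in> F \<longleftrightarrow> X \<in> F" for X
      using flatD[OF assms(1,4,6), of X] flatD[OF assms(1,4,6), of "p \<triangle> (q \<triangle> X)"]
      by (metis sd_cancel sd_left_commute)
    then show ?thesis by (intro set_eqI) (simp add: sd_assoc aff_sd3[OF assms(3)] assms(5,7))
  qed
  then have "card {X \<in> F. aff a c X} = card {X \<in> F. \<not> aff a c X}" by (metis card_shift)
  moreover have "card F = card {X \<in> F. aff a c X} + card {X \<in> F. \<not> aff a c X}"
    using card_Int_Diff[OF assms(2), of "{X. aff a c X}"] by (simp add: Int_def set_diff_eq)
  ultimately show ?thesis by simp
qed

text \<open>A peeling step: each use halves F and keeps A, so a subflat of half the size is cut out
  by one form and one of a quarter of the size by two.\<close>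

lemma flat_separation_half:
  assumes "flat A" "flat F" "A \<subset> F" "F \<subseteq> Pow {..<m::nat}"
  shows "\<exists>a c. a \<subseteq> {..<m} \<and> A \<subseteq> {X \<in> F. aff a c X} \<and> flat {X \<in> F. aff a c X} \<and>
    2 * card {X \<in> F. aff a c X} = card F"
proof -
  obtain x where x: "x \<in> F" "x \<notin> A" using assms by blast
  obtain p where p: "p \<in> A" using assms by (auto simp: flat_def)
  obtain a c where a: "a \<subseteq> {..<m}" "\<And>X. X \<in> A \<Longrightarrow> aff a c X" "\<not> aff a c x"
    using flat_separation[of A m x] assms x by blast
  have fin: "finite a" "finite F"
    using a(1) assms(4) by (auto intro: finite_subset finite_family)
  have "A \<subseteq> {X \<in> F. aff a c X}" using a assms by auto
  moreover have "flat {X \<in> F. aff a c X}" using flat_aff[OF assms(2) fin(1)] p a assms by blast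
  moreover have "2 * card {X \<in> F. aff a c X} = card F"
    using card_flat_aff[OF assms(2) fin(2,1) _ _ x(1) a(3)] p a assms by blast
  ultimately show ?thesis using a(1) by blast
qed

subsection \<open>The weight gap\<close>

lemma exists_nonzero_deriv:
  assumes "degle m r S" "S \<noteq> {}" "S \<noteq> Pow {..<m}"
  obtains v where "v \<subseteq> {..<m}" "deriv v S \<noteq> {}"
proof -
  obtain x where x: "x \<in> S" using assms by blast
  have sub: "S \<subseteq> Pow {..<m}" by (rule degle_subset[OF assms(1)])
  obtain y where y: "y \<subseteq> {..<m}" "y \<notin> S" using assms sub by blast
  have "y \<in> shift (x \<triangle> y) S" using x by (simp add: sd_ac)
  then have "deriv (x \<triangle> y) S \<noteq> {}" unfolding deriv_eq_empty_iff using y by metis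
  moreover have "x \<triangle> y \<subseteq> {..<m}" using x y sub by (intro sd_subset) auto
  ultimately show ?thesis using that by blast
qed

text \<open>If \<open>S\<close> is not contained in the flat \<open>F\<close>, cutting with a half-space that avoids \<open>F\<close>
  costs one degree, which bounds \<open>S - F\<close> from below.\<close>

lemma weight_outside_flat:
  assumes "degle m r S" "flat F" "F \<subseteq> Pow {..<m}" "\<not> S \<subseteq> F"
  shows "\<exists>a c. a \<subseteq> {..<m} \<and> (\<forall>X\<in>F. aff a c X) \<and> {X \<in> S. \<not> aff a c X} \<subseteq> S - F \<and>
    degle m (Suc r) {X \<in> S. \<not> aff a c X} \<and> 2 ^ m \<le> 2 ^ Suc r * card {X \<in> S. \<not> aff a c X}"
proof -
  obtain x where x: "x \<in> S" "x \<notin> F" using assms by blast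
  obtain a c where a: "a \<subseteq> {..<m}" "\<And>X. X \<in> F \<Longrightarrow> aff a c X" "\<not> aff a c x"
    using flat_separation[OF assms(2,3) _ x(2)] degle_subset[OF assms(1)] x by blast
  have "finite a" using a(1) finite_subset by auto
  then have d: "degle m (Suc r) {X \<in> S. \<not> aff a c X}"
    using degle_aff[OF assms(1), of a "\<not> c"] by (simp add: aff_Not)
  moreover have "{X \<in> S. \<not> aff a c X} \<noteq> {}" using a x by blast
  then have "2 ^ m \<le> 2 ^ Suc r * card {X \<in> S. \<not> aff a c X}" by (rule degle_weight[OF d])
  moreover have "{X \<in> S. \<not> aff a c X} \<subseteq> S - F" using a by blast
  ultimately show ?thesis using a by blast
qed

text \<open>Let d be the minimum weight and d < |S| < 3d/2. A nonzero derivative F has fewer than 3d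
  points, so by induction it has exactly 2d and is a flat. If S leaves F, fewer than d/2 of its
  points lie outside, against the half-space bound; if S stays in F, then F - S is a nonempty word
  of the same degree bound with fewer than d points.\<close>

lemma degle_weight_gap:
  assumes "degle m r S" "2 ^ m < 2 ^ r * card S"
  shows "3 * 2 ^ m \<le> 2 * 2 ^ r * card S"
  using assms
proof (induction r arbitrary: S)
  case 0
  then show ?case by (auto simp: card_Pow)
next
  case (Suc r)
  have fin: "finite S" using Suc degle_finite by blast
  show ?case
  proof (rule ccontr)
    assume "\<not> ?thesis"
    then have small: "4 * (2 ^ r * card S) < 3 * 2 ^ m" by simp
    have "S \<noteq> Pow {..<m}"
    proof
      assume "S = Pow {..<m}"
      then have "4 * 2 ^ r * 2 ^ m < 3 * (2::nat) ^ m" using small by (simp add: card_Pow)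
      then have "4 * 2 ^ r < (3::nat)" by (simp only: mult_less_cancel2)
      then show False using one_le_power[of "2::nat" r] by linarith
    qed
    moreover have "S \<noteq> {}" using Suc.prems by auto
    ultimately obtain v where v: "v \<subseteq> {..<m}" "deriv v S \<noteq> {}"
      using exists_nonzero_deriv Suc.prems by metis
    define F where "F = deriv v S"
    have F: "degle m r F" unfolding F_def by (rule degle_deriv[OF Suc.prems(1) v(1)])
    have cF: "card F + 2 * card (S \<inter> shift v S) = 2 * card S"
      unfolding F_def by (rule card_deriv[OF fin])
    have "2 ^ r * card F \<le> 2 ^ r * (2 * card S)" using cF by (intro mult_le_mono2) linarith
    also have "\<dots> = 2 * (2 ^ r * card S)" by simp
    finally have "2 * 2 ^ r * card F < 3 * 2 ^ m" using small by linarith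
    then have "\<not> 2 ^ m < 2 ^ r * card F" using Suc.IH[OF F] by linarith
    then have e: "2 ^ r * card F = 2 ^ m" using degle_weight[OF F] v(2) by (simp add: F_def)
    then have flat: "flat F" by (rule degle_min_weight_flat[OF F])
    have "2 ^ r * (4 * card S) < 2 ^ r * (3 * card F)"
      unfolding mult.left_commute[of "2 ^ r"] e by (rule small)
    then have lt: "4 * card S < 3 * card F" by simp
    have "2 ^ r * card F < 2 ^ r * (2 * card S)"
      using Suc.prems unfolding e by (simp add: mult.left_commute)
    then have gt: "card F < 2 * card S" by simp
    have "S \<subseteq> F"
    proof (rule ccontr)
      assume "\<not> S \<subseteq> F"
      obtain a c where ac: "{X \<in> S. \<not> aff a c X} \<subseteq> S - F"
          "2 ^ m \<le> 2 ^ Suc (Suc r) * card {X \<in> S. \<not> aff a c X}"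
        using weight_outside_flat[OF Suc.prems(1) flat degle_subset[OF F] \<open>\<not> S \<subseteq> F\<close>] by blast
      have "S - F = S \<inter> shift v S" by (auto simp: F_def deriv_def)
      then have "card {X \<in> S. \<not> aff a c X} \<le> card (S \<inter> shift v S)"
        using ac(1) card_mono fin by (metis finite_Int)
      then have "4 * card {X \<in> S. \<not> aff a c X} < card F" using cF lt by linarith
      then have "2 ^ r * (4 * card {X \<in> S. \<not> aff a c X}) < 2 ^ m" unfolding e[symmetric] by simp
      then show False using ac(2) by (simp add: mult.assoc mult.left_commute)
    qed
    then have "S \<triangle> F = F - S" by auto
    then have SF: "card (S \<triangle> F) = card F - card S"
      using card_Diff_subset[OF fin \<open>S \<subseteq> F\<close>] by simp
    have d: "degle m (Suc r) (S \<triangle> F)" using Suc.prems(1) degle_Suc[OF F] by (rule degle_sd)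
    have "card F \<noteq> card S" using lt by linarith
    then have "S \<triangle> F \<noteq> {}" by auto
    then have "2 ^ r * card F \<le> 2 ^ r * (2 * (card F - card S))"
      using degle_weight[OF d] e SF by simp
    then have "card F \<le> 2 * (card F - card S)" by simp
    then show False using gt lt by linarith
  qed
qed

subsection \<open>Words of weight three halves of the minimum\<close>

lemma three_times_power2_neq: "3 * 2 ^ k \<noteq> (2::nat) ^ n"
proof (induction n arbitrary: k)
  case (Suc n)
  show ?case
  proof (cases k)
    case 0
    have "odd (3::nat)" "even ((2::nat) ^ Suc n)" by simp_all
    then show ?thesis using 0 by (metis power_0 mult_1_right)
  next
    case (Suc j)
    then show ?thesis using Suc.IH[of j] by simp
  qed
qed simp

text \<open>Here q is half the minimum weight. Sizes of flats are powers of two, so S is not a flat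
  and two of its points give a direction with nonzero derivative. These points also make the overlap
  nonempty, so the derivative has fewer than 6q points, and the weight gap forces 4q.\<close>

lemma three_halves_split:
  assumes d: "degle m r S" and w: "2 * (2 ^ r * card S) = 3 * 2 ^ m"
  shows "\<exists>s q v a c. r = Suc s \<and> s \<noteq> 0 \<and> v \<subseteq> {..<m} \<and> q \<noteq> 0 \<and> 2 ^ s * (4 * q) = 2 ^ m \<and> card S = 3 * q \<and>
    degle m s (deriv v S) \<and> flat (deriv v S) \<and> card (deriv v S) = 4 * q \<and>
    flat (S \<inter> shift v S) \<and> card (S \<inter> shift v S) = q \<and>
    a \<subseteq> {..<m} \<and> (\<forall>X \<in> deriv v S. aff a c X) \<and> (\<forall>X \<in> S \<inter> shift v S. \<not> aff a c X)"
proof -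
  have fin: "finite S" and sub: "S \<subseteq> Pow {..<m}" using d degle_finite degle_subset by auto
  have ne: "S \<noteq> {}" using w by auto
  have "r \<noteq> 0"
  proof
    assume "r = 0"
    then have "2 * card S = 3 * 2 ^ m" using w by simp
    moreover have "card S \<le> 2 ^ m" using card_mono[OF _ sub] by (simp add: card_Pow)
    moreover have "(0::nat) < 2 ^ m" by simp
    ultimately show False by linarith
  qed
  then obtain s where r: "r = Suc s" by (cases r) auto
  have "\<not> flat S"
  proof
    assume "flat S"
    then obtain k where "2 ^ k * card S = 2 ^ m" using flat_card_power2 sub by metis
    then have "(2 ^ Suc r) * card S = (3 * 2 ^ k) * card S" using w by (simp add: mult.assoc)
    moreover have "card S \<noteq> 0" using fin ne by simp
    ultimately have "2 ^ Suc r = 3 * (2::nat) ^ k" by (metis mult_cancel2)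
    then show False using three_times_power2_neq by metis
  qed
  then obtain x y where xy: "x \<in> S" "y \<in> S" "shift (x \<triangle> y) S \<noteq> S"
    using flatI_shift ne by metis
  define v where "v = x \<triangle> y"
  define F where "F = deriv v S"
  define A where "A = S \<inter> shift v S"
  define q where "q = card A"
  have v: "v \<subseteq> {..<m}" unfolding v_def using xy sub by (intro sd_subset) auto
  have F: "degle m s F" unfolding F_def by (rule degle_deriv[OF d[unfolded r] v])
  have F0: "F \<noteq> {}" using xy by (simp only: F_def v_def deriv_eq_empty_iff not_False_eq_True)
  have "x \<in> A" using xy by (simp add: A_def v_def sd_ac)
  moreover have finA: "finite A" using fin by (simp add: A_def)
  ultimately have q: "q \<noteq> 0" by (auto simp: q_def)
  have cF: "card F + 2 * q = 2 * card S"
    unfolding F_def q_def A_def by (rule card_deriv[OF fin])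
  have w': "4 * (2 ^ s * card S) = 3 * 2 ^ m" using w r by simp
  have "2 ^ s * card F < 2 ^ s * (2 * card S)" using cF q by simp
  also have "\<dots> = 2 * (2 ^ s * card S)" by simp
  finally have "\<not> 3 * 2 ^ m \<le> 2 * 2 ^ s * card F" using w' by linarith
  then have "\<not> 2 ^ m < 2 ^ s * card F" using degle_weight_gap[OF F] by blast
  then have e: "2 ^ s * card F = 2 ^ m" using degle_weight[OF F F0] by simp
  then have flatF: "flat F" by (rule degle_min_weight_flat[OF F])
  have "2 ^ s * (4 * card S) = 2 ^ s * (3 * card F)"
    unfolding mult.left_commute[of "2 ^ s"] e by (rule w')
  then have "4 * card S = 3 * card F" by simp
  then have cards: "card S = 3 * q" "card F = 4 * q" using cF by linarith+
  have eq: "2 ^ s * (4 * q) = 2 ^ m" using e cards by simp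
  \<comment> \<open>Inside F the q missing points would form a word of degree r below the minimum
    weight 2q.\<close>
  have "\<not> S \<subseteq> F"
  proof
    assume SF: "S \<subseteq> F"
    then have "S \<triangle> F = F - S" by (auto simp: sd_def)
    then have c: "card (S \<triangle> F) = q" using card_Diff_subset[OF fin SF] cards by simp
    have dSF: "degle m r (S \<triangle> F)" using d degle_Suc[OF F] unfolding r by (rule degle_sd)
    have "S \<triangle> F \<noteq> {}" using c q by auto
    then have "2 ^ s * (4 * q) \<le> 2 ^ s * (2 * q)"
      unfolding eq using degle_weight[OF dSF] c r by (simp add: mult.assoc mult.left_commute)
    then show False using q by simp
  qed
  obtain a c where a: "a \<subseteq> {..<m}" "\<And>X. X \<in> F \<Longrightarrow> aff a c X"
      "{X \<in> S. \<not> aff a c X} \<subseteq> S - F" "degle m (Suc r) {X \<in> S. \<not> aff a c X}"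
      "2 ^ m \<le> 2 ^ Suc r * card {X \<in> S. \<not> aff a c X}"
    using weight_outside_flat[OF d flatF degle_subset[OF F] \<open>\<not> S \<subseteq> F\<close>] by blast
  have "S - F = A" by (auto simp: F_def A_def deriv_def)
  then have A': "{X \<in> S. \<not> aff a c X} \<subseteq> A" using a(3) by simp
  have "2 ^ s * (4 * q) \<le> 2 ^ s * (4 * card {X \<in> S. \<not> aff a c X})" using a(5) eq r by simp
  then have "q \<le> card {X \<in> S. \<not> aff a c X}" by simp
  \<comment> \<open>The half-space avoiding F holds at least q points of S, all of them in A, and A
    has only q. So A is S cut by one form: degree r + 1, with the minimum weight for that
    degree.\<close>
  then have A: "{X \<in> S. \<not> aff a c X} = A"
    using card_seteq[OF finA A'] by (simp add: q_def)
  have "2 ^ Suc r * card A = 2 ^ m" using eq r by (simp add: q_def)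
  then have flatA: "flat A" using degle_min_weight_flat a(4) A by simp
  \<comment> \<open>For s = 0 the flat F would be the whole space and contain S.\<close>
  have "s \<noteq> 0"
  proof
    assume "s = 0"
    then have "card F = card (Pow {..<m})" using e by (simp add: card_Pow)
    then have "F = Pow {..<m}" using card_subset_eq[OF _ degle_subset[OF F]] by simp
    then show False using \<open>\<not> S \<subseteq> F\<close> sub by simp
  qed
  have "\<forall>X \<in> A. \<not> aff a c X" using A by blast
  then show ?thesis
    using r \<open>s \<noteq> 0\<close> v q eq cards F flatF flatA a(1,2) unfolding F_def A_def q_def by blast
qed

text \<open>The overlap \<open>A\<close> is too light to have degree \<open>r\<close>; hence \<open>S - A\<close> is not a flat, so it
  spans the flat \<open>F\<close>, which therefore is invariant under every direction of \<open>A\<close>.\<close>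

lemma three_halves_direction:
  assumes d: "degle m (Suc s) S" and v: "v \<subseteq> {..<m}" and q: "q \<noteq> 0" "2 ^ s * (4 * q) = 2 ^ m" "card S = 3 * q"
    and F: "degle m s F" "flat F" "card F = 4 * q" "F = deriv v S"
    and A: "flat A" "card A = q" "A = S \<inter> shift v S"
    and u: "x \<in> A" "y \<in> A"
  shows "shift (x \<triangle> y) F = F"
proof -
  define u where "u = x \<triangle> y"
  define B where "B = S - A"
  have fin: "finite S" and sub: "S \<subseteq> Pow {..<m}" using d degle_finite degle_subset by auto
  have finA: "finite A" "A \<subseteq> S" using A(3) fin by auto
  have u': "u \<subseteq> {..<m}" unfolding u_def using u finA sub by (intro sd_subset) auto
  have "X \<in> shift u A \<longleftrightarrow> X \<in> A" for X
    using flatD[OF A(1) u, of X] flatD[OF A(1) u, of "x \<triangle> (y \<triangle> X)"]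
    by (simp add: u_def sd_assoc) (metis sd_cancel sd_left_commute)
  then have uA: "shift u A = A" by blast
  have SAB: "S = A \<triangle> B" using finA by (auto simp: B_def)
  have cB: "card B = 2 * q" using card_Diff_subset[OF finA] q(3) A(2) by (simp add: B_def)
  have finB: "finite B" using fin by (simp add: B_def)
  \<comment> \<open>Since A is invariant under u, it drops out of the derivative.\<close>
  have uB: "deriv u S = B \<triangle> shift u B"
    unfolding SAB deriv_def shift_sd uA by (simp add: sd_assoc sd_left_commute)
  have BF: "B \<subseteq> F" unfolding F(4) A(3) B_def by (auto simp: deriv_def)
  have "shift u F = F"
  proof (cases "deriv u S = {}")
    case True
    then have "shift u S = S" by (simp only: deriv_eq_empty_iff)
    then show ?thesis unfolding F(4) deriv_def shift_sd shift_commute[of u v] by simp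
  next
    case False
    \<comment> \<open>The minimum weight gives |G| at least 4q, and 2|B| = 4q bounds it above. So B
      is disjoint from its translate and survives entirely in G.\<close>
    define G where "G = deriv u S"
    have G: "degle m s G" unfolding G_def by (rule degle_deriv[OF d u'])
    have "card G + 2 * card (B \<inter> shift u B) = 4 * q"
      using card_sd[OF finB finite_shift[OF finB, of u]] cB by (simp add: G_def uB)
    moreover have "2 ^ s * (4 * q) \<le> 2 ^ s * card G"
      using degle_weight[OF G] False q(2) by (simp add: G_def)
    then have "4 * q \<le> card G" by simp
    ultimately have cG: "card G = 4 * q" and "card (B \<inter> shift u B) = 0" by linarith+
    then have "B \<inter> shift u B = {}" using finB by simp
    then have BG: "B \<subseteq> G" unfolding G_def uB by (auto simp: set_eq_iff)
    have flatG: "flat G" by (rule degle_min_weight_flat[OF G]) (simp add: cG q(2))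
    have "F = G"
    proof (rule ccontr)
      assume FG: "F \<noteq> G"
      have finF: "finite F" using F degle_finite by blast
      have BFG: "B \<subseteq> F \<inter> G" using BF BG by simp
      have "B \<noteq> {}" using cB q(1) by auto
      then have ne: "F \<inter> G \<noteq> {}" using BFG by blast
      have flFG: "flat (F \<inter> G)" using flat_Int[OF F(2) flatG ne] .
      have subFG: "F \<inter> G \<subseteq> Pow {..<m}" using degle_subset[OF F(1)] by blast
      obtain k where k: "2 ^ k * card (F \<inter> G) = 2 ^ m"
        using flat_card_power2[OF flFG subFG] by metis
      have "F \<inter> G \<noteq> F" using FG F(3) cG card_subset_eq[OF degle_finite[OF G], of F] by auto
      then have lt: "card (F \<inter> G) < card F" using finF by (intro psubset_card_mono) auto
      \<comment> \<open>Sizes of flats are powers of two, so a proper subflat of F has at most half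
        of its points, and B already fills that half.\<close>
      have "s < k"
      proof (rule ccontr)
        assume "\<not> s < k"
        then have "(2::nat) ^ k \<le> 2 ^ s" by simp
        then have "2 ^ k * card (F \<inter> G) < 2 ^ s * card F" using lt
          by (meson le_less_trans mult_le_mono1 mult_less_cancel1 zero_less_numeral zero_less_power)
        then show False using k q(2) F(3) by simp
      qed
      then have "(2::nat) ^ Suc s \<le> 2 ^ k" by (intro power_increasing) auto
      then have "2 ^ Suc s * card (F \<inter> G) \<le> 2 ^ k * card (F \<inter> G)" by (rule mult_le_mono1)
      also have "\<dots> = 2 ^ Suc s * (2 * q)" unfolding k q(2)[symmetric] by simp
      finally have "card (F \<inter> G) \<le> 2 * q" by simp
      then have "card (F \<inter> G) \<le> card B" using cB by simp
      then have B: "B = F \<inter> G" using card_seteq[OF _ BFG] finF by simp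
      have "degle m (Suc s) B"
        using degle_flat[OF flFG subFG, of "Suc s"] B cB q(2) by simp
      then have "degle m (Suc s) (S \<triangle> B)" by (rule degle_sd[OF d])
      then have dA: "degle m (Suc s) A" by (simp add: SAB sd_assoc)
      have "A \<noteq> {}" using u by blast
      then have "2 ^ s * (4 * q) \<le> 2 ^ s * (2 * q)"
        unfolding q(2) using degle_weight[OF dA] A(2) by (simp add: mult.assoc mult.left_commute)
      then show False using q(1) by simp
    qed
    \<comment> \<open>A derivative in direction u is invariant under u.\<close>
    then show ?thesis by (simp add: G_def shift_deriv)
  qed
  then show ?thesis by (simp add: u_def)
qed

text \<open>Every point is a point of F plus an offset from {0, t}, and three such offsets again add
  up to an element of {0, t}.\<close>

lemma flat_Un_shift:
  assumes "flat F"
  shows "flat (F \<union> shift t F)"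
  unfolding flat_def
proof (intro conjI ballI)
  show "F \<union> shift t F \<noteq> {}" using assms by (auto simp: flat_def)
  fix X Y Z assume *: "X \<in> F \<union> shift t F" "Y \<in> F \<union> shift t F" "Z \<in> F \<union> shift t F"
  have ex: "\<exists>e \<in> {{}, t}. e \<triangle> W \<in> F" if "W \<in> F \<union> shift t F" for W using that by auto
  obtain x y z where e: "x \<in> {{}, t}" "y \<in> {{}, t}" "z \<in> {{}, t}"
    and F: "x \<triangle> X \<in> F" "y \<triangle> Y \<in> F" "z \<triangle> Z \<in> F"
    using ex[OF *(1)] ex[OF *(2)] ex[OF *(3)] by blast
  have "(x \<triangle> X) \<triangle> ((y \<triangle> Y) \<triangle> (z \<triangle> Z)) = (x \<triangle> (y \<triangle> z)) \<triangle> (X \<triangle> (Y \<triangle> Z))"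
    by (simp add: sd_ac)
  then have "(x \<triangle> (y \<triangle> z)) \<triangle> (X \<triangle> (Y \<triangle> Z)) \<in> F" using flatD[OF assms F] by simp
  moreover have "x \<triangle> (y \<triangle> z) \<in> {{}, t}" using e by auto
  ultimately show "X \<triangle> (Y \<triangle> Z) \<in> F \<union> shift t F" by auto
qed

text \<open>The factor 16 encodes independence of the four forms: their joint fibre is a sixteenth
  of T. It comes from B = G + E1 with sizes 2q, 2q and q, which leaves q/2 points in
  \<open>G \<inter> E1\<close>, against |T| = 8q.\<close>

lemma three_halves_structure:
  assumes d: "degle m r S" and w: "2 * (2 ^ r * card S) = 3 * 2 ^ m"
  shows "\<exists>k T a1 c1 a2 c2 a3 c3 a4 c4. r = Suc (Suc k) \<and> flat T \<and> T \<subseteq> Pow {..<m} \<and> 2 ^ k * card T = 2 ^ m \<and>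
    a1 \<subseteq> {..<m} \<and> a2 \<subseteq> {..<m} \<and> a3 \<subseteq> {..<m} \<and> a4 \<subseteq> {..<m} \<and>
    S = {X \<in> T. (aff a1 c1 X \<and> aff a2 c2 X) \<noteq> (aff a3 c3 X \<and> aff a4 c4 X)} \<and>
    16 * card {X \<in> T. aff a1 c1 X \<and> aff a2 c2 X \<and> aff a3 c3 X \<and> aff a4 c4 X} = card T"
proof -
  from three_halves_split[OF d w] obtain s q v a1 c1 where r: "r = Suc s" "s \<noteq> 0" and v: "v \<subseteq> {..<m}"
    and q: "q \<noteq> 0" "2 ^ s * (4 * q) = 2 ^ m" "card S = 3 * q"
    and F': "degle m s (deriv v S)" "flat (deriv v S)" "card (deriv v S) = 4 * q"
    and A': "flat (S \<inter> shift v S)" "card (S \<inter> shift v S) = q"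
    and a1: "a1 \<subseteq> {..<m}" "\<forall>X \<in> deriv v S. aff a1 c1 X" "\<forall>X \<in> S \<inter> shift v S. \<not> aff a1 c1 X"
    by (elim exE conjE)
  define F where "F = deriv v S"
  define A where "A = S \<inter> shift v S"
  define B where "B = S - A"
  note F = F'[folded F_def] and A = A'[folded A_def] and l1 = a1(2,3)[folded F_def A_def, rule_format]
  obtain k where k: "s = Suc k" using r(2) by (cases s) auto
  have fin: "finite S" and sub: "S \<subseteq> Pow {..<m}" using d degle_finite degle_subset by auto
  have finF: "finite F" and subF: "F \<subseteq> Pow {..<m}" using F(1) degle_finite degle_subset by auto
  have finA: "finite A" and AS: "A \<subseteq> S" using fin by (auto simp: A_def)
  have fin_form: "finite a" if "a \<subseteq> {..<m}" for a using that finite_subset by auto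
  have BF: "B \<subseteq> F" by (auto simp: B_def A_def F_def deriv_def)
  have cB: "card B = 2 * q" using card_Diff_subset[OF finA AS] q(3) A(2) by (simp add: B_def)
  obtain a0 x0 where a0: "a0 \<in> A" and x0: "x0 \<in> F" using A(1) F(2) by (auto simp: flat_def)
  \<comment> \<open>\<open>F2\<close> is the translate of F through a point of A, and T is the flat
    spanned by F and that point.\<close>
  define t where "t = a0 \<triangle> x0"
  define F2 where "F2 = shift t F"
  define T where "T = F \<union> F2"
  have flatT: "flat T" unfolding T_def F2_def by (rule flat_Un_shift[OF F(2)])
  have t: "t \<subseteq> {..<m}" unfolding t_def using a0 x0 AS sub subF by (intro sd_subset) auto
  have subT: "T \<subseteq> Pow {..<m}"
  proof
    fix X assume "X \<in> T"
    then have "X \<in> Pow {..<m} \<or> t \<triangle> X \<in> Pow {..<m}" using subF by (auto simp: T_def F2_def)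
    then show "X \<in> Pow {..<m}" using sd_subset[OF t, of "t \<triangle> X"] by auto
  qed
  have finT: "finite T" using subT by (rule finite_family)
  have l1F2: "\<not> aff a1 c1 X" if "X \<in> F2" for X
  proof -
    have "aff a1 c1 (a0 \<triangle> (x0 \<triangle> X))"
      using that l1(1) unfolding F2_def in_shift t_def sd_assoc by blast
    then show ?thesis
      using aff_sd3[OF fin_form[OF a1(1)], of c1 a0 x0 X] l1(1)[OF x0] l1(2)[OF a0] by simp
  qed
  have F_eq: "F = {X \<in> T. aff a1 c1 X}" and F2_eq: "F2 = {X \<in> T. \<not> aff a1 c1 X}"
    using l1(1) l1F2 unfolding T_def by blast+
  have cF2: "card F2 = 4 * q" using F(3) by (simp add: F2_def)
  have cT: "card T = 8 * q"
  proof -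
    have "F \<inter> F2 = {}" using l1(1) l1F2 by blast
    then show ?thesis using card_Un_disjoint[of F F2] finF F(3) cF2 by (simp add: T_def F2_def)
  qed
  \<comment> \<open>All directions of A preserve F, so A stays in the one translate through
    \<open>a0\<close>.\<close>
  have AT: "A \<subseteq> F2"
  proof
    fix X assume "X \<in> A"
    then have "shift (a0 \<triangle> X) F = F"
      by (rule three_halves_direction[OF d[unfolded r(1)] v q F F_def A A_def a0])
    then have "(a0 \<triangle> X) \<triangle> x0 \<in> F" using x0 in_shift[of x0 "a0 \<triangle> X" F] by simp
    then show "X \<in> F2" by (simp add: F2_def t_def sd_ac)
  qed
  have ST: "S \<subseteq> T" using AT BF by (auto simp: T_def B_def)
  have flatF2: "flat F2"
    using flat_aff[OF flatT fin_form[OF a1(1)], of a0 "\<not> c1"] a0 AT l1(2)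
    by (auto simp: aff_Not F2_eq)
  have "A \<noteq> F2" using A(2) cF2 q(1) by auto
  then obtain a3 c3 where a3: "a3 \<subseteq> {..<m}" "A \<subseteq> {X \<in> F2. aff a3 c3 X}" "flat {X \<in> F2. aff a3 c3 X}"
      "2 * card {X \<in> F2. aff a3 c3 X} = card F2"
    using flat_separation_half[OF A(1) flatF2, of m] AT subT unfolding T_def by blast
  define F3 where "F3 = {X \<in> F2. aff a3 c3 X}"
  have F3: "A \<subseteq> F3" "flat F3" "card F3 = 2 * q" using a3 cF2 by (simp_all add: F3_def)
  have "A \<noteq> F3" using A(2) F3(3) q(1) by auto
  moreover have F3T: "F3 \<subseteq> Pow {..<m}" using subT by (auto simp: F3_def T_def)
  ultimately obtain a4 c4 where a4: "a4 \<subseteq> {..<m}" "A \<subseteq> {X \<in> F3. aff a4 c4 X}"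
      "2 * card {X \<in> F3. aff a4 c4 X} = card F3"
    using flat_separation_half[OF A(1) F3(2), of m] F3(1) by blast
  have "A = {X \<in> F3. aff a4 c4 X}"
    by (rule card_seteq[OF _ a4(2)]) (use finite_family[OF F3T] a4(3) F3(3) A(2) in auto)
  then have A_eq: "A = {X \<in> F2. aff a3 c3 X \<and> aff a4 c4 X}" by (auto simp: F3_def)
  \<comment> \<open>The two equations that cut A out of \<open>F2\<close>, extended to all of T. On
    \<open>F2\<close> both S and E reduce to A, so their sum G lives in F.\<close>
  define E where "E = {X \<in> {X \<in> T. aff a3 c3 X}. aff a4 c4 X}"
  define E1 where "E1 = {X \<in> E. aff a1 c1 X}"
  have AE: "A = {X \<in> E. \<not> aff a1 c1 X}" by (auto simp: A_eq E_def F2_eq)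
  have finE: "finite E" using finT by (simp add: E_def)
  have dT: "degle m k T" using degle_flat[OF flatT subT] cT q(2) k by simp
  have dE: "degle m r E"
    unfolding E_def r k by (intro degle_aff dT fin_form a3(1) a4(1))
  have flatE: "flat E"
    unfolding E_def using a0 AT AE
    by (intro flat_aff[OF flat_aff[OF flatT fin_form[OF a3(1)]] fin_form[OF a4(1)]]) (auto simp: E_def)
  have light: "2 * q \<le> card H" if "degle m r H" "H \<noteq> {}" for H
  proof -
    have "2 ^ s * (4 * q) \<le> 2 ^ s * (2 * card H)"
      unfolding q(2) using degle_weight[OF that] r by (simp add: mult.assoc mult.left_commute)
    then show ?thesis by simp
  qed
  have cE: "card E = card E1 + q"
    using card_Int_Diff[OF finE, of "{X. aff a1 c1 X}"] A(2) AE by (simp add: E1_def Int_def set_diff_eq)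
  \<comment> \<open>Otherwise E would equal A, which is too light for a nonzero word of degree
    r.\<close>
  have "E1 \<noteq> {}"
  proof
    assume "E1 = {}"
    then have "card E = q" using cE by simp
    then show False using light[OF dE] q(1) a0 AE by auto
  qed
  then obtain p where p: "p \<in> E" "aff a1 c1 p" by (auto simp: E1_def)
  have "2 * card E1 = card E"
    unfolding E1_def
    by (rule card_flat_aff[OF flatE finE fin_form[OF a1(1)] p, of a0]) (use a0 AE in auto)
  then have cE1: "card E1 = q" using cE by simp
  define G where "G = S \<triangle> E"
  have finB: "finite B" and finE1: "finite E1" using fin finE by (auto simp: B_def E1_def)
  have B_eq: "B = {X \<in> S. aff a1 c1 X}"
    using l1 BF AS unfolding B_def by blast
  have G_eq: "G = B \<triangle> E1"
  proof (rule set_eqI)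
    fix X
    have "X \<in> A \<longleftrightarrow> X \<in> S \<and> \<not> aff a1 c1 X" using B_eq AS unfolding B_def by blast
    then show "X \<in> G \<longleftrightarrow> X \<in> B \<triangle> E1"
      using AE unfolding G_def B_eq E1_def in_sd mem_Collect_eq by blast
  qed
  have dG: "degle m r G" unfolding G_def by (rule degle_sd[OF d dE])
  have GF: "G \<subseteq> F" using BF by (auto simp: G_eq E1_def E_def F_eq)
  have finG: "finite G" using dG degle_finite by blast
  have "card G + 2 * card (B \<inter> E1) = 3 * q"
    using card_sd[OF finB finE1] cB cE1 by (simp add: G_eq)
  moreover have "card (B \<inter> E1) \<le> q" using card_mono[OF finE1, of "B \<inter> E1"] cE1 by simp
  ultimately have bounds: "q \<le> card G" "card G \<le> 3 * q" by linarith+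
  then have "G \<noteq> {}" using q(1) by auto
  then have G2: "2 * q \<le> card G" by (rule light[OF dG])
  \<comment> \<open>The complement of G in F also has degree at most r, so the minimum weight bounds
    |G| from both sides and leaves only 2q.\<close>
  have "F \<triangle> G = F - G" using GF by auto
  then have cFG: "card (F \<triangle> G) = 4 * q - card G" using card_Diff_subset[OF finG GF] F(3) by simp
  have "degle m r (F \<triangle> G)" using degle_Suc[OF F(1)] dG unfolding r(1) by (rule degle_sd)
  moreover have "F \<triangle> G \<noteq> {}" using F(3) bounds q(1) by auto
  ultimately have "2 * q \<le> card (F \<triangle> G)" by (rule light)
  then have cG: "card G = 2 * q" using cFG G2 q(1) by linarith
  have flatG: "flat G" by (rule degle_min_weight_flat[OF dG]) (use cG q(2) r in simp)
  have "G \<noteq> F" using cG F(3) q(1) by auto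
  then obtain a2 c2 where a2: "a2 \<subseteq> {..<m}" "G \<subseteq> {X \<in> F. aff a2 c2 X}" "2 * card {X \<in> F. aff a2 c2 X} = card F"
    using flat_separation_half[OF flatG F(2) _ subF] GF by blast
  have "G = {X \<in> F. aff a2 c2 X}"
    by (rule card_seteq[OF _ a2(2)]) (use finF a2(3) F(3) cG in auto)
  then have G_form: "G = {X \<in> T. aff a1 c1 X \<and> aff a2 c2 X}" by (auto simp: F_eq)
  have "S = G \<triangle> E" by (simp add: G_def sd_ac)
  then have S_eq: "S = {X \<in> T. (aff a1 c1 X \<and> aff a2 c2 X) \<noteq> (aff a3 c3 X \<and> aff a4 c4 X)}"
    unfolding G_form E_def sd_def by blast
  have "B = G \<triangle> E1" by (simp add: G_eq sd_ac)
  then have "2 * q + 2 * card (G \<inter> E1) = 3 * q" using card_sd[OF finG finE1] cB cG cE1 by simp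
  moreover have "G \<inter> E1 = {X \<in> T. aff a1 c1 X \<and> aff a2 c2 X \<and> aff a3 c3 X \<and> aff a4 c4 X}"
    by (auto simp: G_form E1_def E_def)
  ultimately have "16 * card {X \<in> T. aff a1 c1 X \<and> aff a2 c2 X \<and> aff a3 c3 X \<and> aff a4 c4 X} = card T"
    using cT by simp
  moreover have "2 ^ k * card T = 2 ^ m" using cT q(2) k by simp
  ultimately show ?thesis
    using r(1) k flatT subT a1(1) a2(1) a3(1) a4(1) S_eq by blast
qed

subsection \<open>Elimination for two hyperbolic planes\<close>

type_synonym form = "nat set \<times> bool"

definition fapp :: "form \<Rightarrow> nat set \<Rightarrow> bool" where "fapp l X = aff (fst l) (snd l) X"
definition fadd :: "form \<Rightarrow> form \<Rightarrow> form" where "fadd l k = (fst l \<triangle> fst k, snd l \<noteq> snd k)"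
definition fnot :: "form \<Rightarrow> form" where "fnot l = (fst l, \<not> snd l)"

lemma fst_fadd [simp]: "fst (fadd l k) = fst l \<triangle> fst k" by (simp add: fadd_def)
lemma fst_fnot [simp]: "fst (fnot l) = fst l" by (simp add: fnot_def)

lemma fapp_fnot [simp]: "fapp (fnot l) X \<longleftrightarrow> \<not> fapp l X"
  by (simp add: fapp_def fnot_def aff_Not)

lemma fapp_fadd:
  "finite (fst l) \<Longrightarrow> finite (fst k) \<Longrightarrow> fapp (fadd l k) X \<longleftrightarrow> fapp l X \<noteq> fapp k X"
  unfolding fapp_def fadd_def fst_conv snd_conv by (rule aff_sd)

text \<open>The last conjunct states linear independence of the four linear parts as joint
  surjectivity. Each substitution below preserves it by solving for the old values, without any rank
  argument.\<close>

definition hyperbolic :: "nat set \<Rightarrow> (nat set \<Rightarrow> bool) \<Rightarrow> form \<Rightarrow> form \<Rightarrow> form \<Rightarrow> form \<Rightarrow> bool" where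
  "hyperbolic K p l1 l2 l3 l4 \<longleftrightarrow> finite K \<and> fst l1 \<subseteq> K \<and> fst l2 \<subseteq> K \<and> fst l3 \<subseteq> K \<and> fst l4 \<subseteq> K \<and>
    (\<forall>X \<subseteq> K. p X \<longleftrightarrow> (fapp l1 X \<and> fapp l2 X) \<noteq> (fapp l3 X \<and> fapp l4 X)) \<and>
    (\<forall>b1 b2 b3 b4. \<exists>X \<subseteq> K. fapp l1 X = b1 \<and> fapp l2 X = b2 \<and> fapp l3 X = b3 \<and> fapp l4 X = b4)"

lemma hyperbolic_finite:
  assumes "hyperbolic K p l1 l2 l3 l4"
  shows "finite (fst l1)" "finite (fst l2)" "finite (fst l3)" "finite (fst l4)"
  using assms unfolding hyperbolic_def by (auto intro: finite_subset[of _ K])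

lemma hyperbolicI:
  assumes "finite K" "fst l1 \<subseteq> K" "fst l2 \<subseteq> K" "fst l3 \<subseteq> K" "fst l4 \<subseteq> K"
    "\<And>X. X \<subseteq> K \<Longrightarrow> p X \<longleftrightarrow> (fapp l1 X \<and> fapp l2 X) \<noteq> (fapp l3 X \<and> fapp l4 X)"
    "\<And>b1 b2 b3 b4. \<exists>X \<subseteq> K. fapp l1 X = b1 \<and> fapp l2 X = b2 \<and> fapp l3 X = b3 \<and> fapp l4 X = b4"
  shows "hyperbolic K p l1 l2 l3 l4"
  unfolding hyperbolic_def using assms by (intro conjI allI impI)

lemma hyperbolicD:
  assumes "hyperbolic K p l1 l2 l3 l4"
  shows "finite K" "fst l1 \<subseteq> K" "fst l2 \<subseteq> K" "fst l3 \<subseteq> K" "fst l4 \<subseteq> K"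
    "\<And>X. X \<subseteq> K \<Longrightarrow> p X \<longleftrightarrow> (fapp l1 X \<and> fapp l2 X) \<noteq> (fapp l3 X \<and> fapp l4 X)"
    "\<exists>X \<subseteq> K. fapp l1 X = b1 \<and> fapp l2 X = b2 \<and> fapp l3 X = b3 \<and> fapp l4 X = b4"
  using assms unfolding hyperbolic_def by simp_all

lemma hyperbolic_swap:
  assumes h: "hyperbolic K p l1 l2 l3 l4"
  shows "hyperbolic K p l2 l1 l3 l4"
proof (rule hyperbolicI)
  show "\<exists>X \<subseteq> K. fapp l2 X = b1 \<and> fapp l1 X = b2 \<and> fapp l3 X = b3 \<and> fapp l4 X = b4" for b1 b2 b3 b4
    using hyperbolicD(7)[OF h, of b2 b1 b3 b4] by blast
qed (use hyperbolicD(1-6)[OF h] in auto)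

lemma hyperbolic_swap_pairs:
  assumes h: "hyperbolic K p l1 l2 l3 l4"
  shows "hyperbolic K p l3 l4 l1 l2"
proof (rule hyperbolicI)
  show "\<exists>X \<subseteq> K. fapp l3 X = b1 \<and> fapp l4 X = b2 \<and> fapp l1 X = b3 \<and> fapp l2 X = b4" for b1 b2 b3 b4
    using hyperbolicD(7)[OF h, of b3 b4 b1 b2] by blast
qed (use hyperbolicD(1-6)[OF h] in auto)

text \<open>The moves use \<open>u v = u (v + u + 1)\<close> and \<open>u v + w z = u (v + z) + (w + u) z\<close>.\<close>

lemma hyperbolic_square:
  assumes h: "hyperbolic K p l1 l2 l3 l4"
  shows "hyperbolic K p l1 (fnot (fadd l2 l1)) l3 l4"
proof (rule hyperbolicI)
  note fin = hyperbolic_finite[OF h]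
  note fa = fapp_fadd[OF fin(2) fin(1)]
  show "\<exists>X \<subseteq> K. fapp l1 X = b1 \<and> fapp (fnot (fadd l2 l1)) X = b2 \<and> fapp l3 X = b3 \<and> fapp l4 X = b4"
    for b1 b2 b3 b4
  proof -
    obtain X where "X \<subseteq> K" "fapp l1 X = b1" "fapp l2 X = (b2 = b1)" "fapp l3 X = b3" "fapp l4 X = b4"
      using hyperbolicD(7)[OF h, of b1 "b2 = b1" b3 b4] by blast
    then show ?thesis by (intro exI[of _ X]) (auto simp: fa)
  qed
  show "p X \<longleftrightarrow> (fapp l1 X \<and> fapp (fnot (fadd l2 l1)) X) \<noteq> (fapp l3 X \<and> fapp l4 X)"
    if "X \<subseteq> K" for X
    using hyperbolicD(6)[OF h that] by (auto simp: fa)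
qed (use hyperbolicD(1-5)[OF h] in \<open>simp_all add: sd_subset\<close>)

lemma hyperbolic_transvection:
  assumes h: "hyperbolic K p l1 l2 l3 l4"
  shows "hyperbolic K p l1 (fadd l2 l4) (fadd l3 l1) l4"
proof (rule hyperbolicI)
  note fin = hyperbolic_finite[OF h]
  note fa = fapp_fadd[OF fin(2) fin(4)] fapp_fadd[OF fin(3) fin(1)]
  show "\<exists>X \<subseteq> K. fapp l1 X = b1 \<and> fapp (fadd l2 l4) X = b2 \<and> fapp (fadd l3 l1) X = b3 \<and> fapp l4 X = b4"
    for b1 b2 b3 b4
  proof -
    obtain X where "X \<subseteq> K" "fapp l1 X = b1" "fapp l2 X = (b2 \<noteq> b4)" "fapp l3 X = (b3 \<noteq> b1)" "fapp l4 X = b4"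
      using hyperbolicD(7)[OF h, of b1 "b2 \<noteq> b4" "b3 \<noteq> b1" b4] by blast
    then show ?thesis by (intro exI[of _ X]) (auto simp: fa)
  qed
  show "p X \<longleftrightarrow> (fapp l1 X \<and> fapp (fadd l2 l4) X) \<noteq> (fapp (fadd l3 l1) X \<and> fapp l4 X)"
    if "X \<subseteq> K" for X
    using hyperbolicD(6)[OF h that] by (auto simp: fa)
qed (use hyperbolicD(1-5)[OF h] in \<open>simp_all add: sd_subset\<close>)

lemma hyperbolic_transvection':
  assumes "hyperbolic K p l1 l2 l3 l4"
  shows "hyperbolic K p l1 (fadd l2 l3) l3 (fadd l4 l1)"
proof -
  have swap: "hyperbolic K p k1 k2 k4 k3" if "hyperbolic K p k1 k2 k3 k4" for k1 k2 k3 k4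
    by (rule hyperbolic_swap_pairs[OF hyperbolic_swap[OF hyperbolic_swap_pairs[OF that]]])
  show ?thesis by (rule swap[OF hyperbolic_transvection[OF swap[OF assms]]])
qed

text \<open>A form without variables cannot take both values; this secures the existence of leading
  variables.\<close>

lemma hyperbolic_nonempty:
  assumes "hyperbolic K p l1 l2 l3 l4"
  shows "fst l1 \<noteq> {}"
proof
  assume "fst l1 = {}"
  then have "fapp l1 X \<longleftrightarrow> snd l1" for X by (simp add: fapp_def aff_def)
  moreover obtain X where "fapp l1 X = (\<not> snd l1)"
    using hyperbolicD(7)[OF assms] by blast
  ultimately show False by simp
qed

text \<open>\<alpha> is the largest variable of all four forms. A transvection clearing \<alpha>
  from \<open>l3\<close> or \<open>l4\<close> also changes \<open>l2\<close>, whereas the square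
  move changes only \<open>l2\<close>; so \<open>l2\<close> is cleared last.\<close>

lemma hyperbolic_leading_first:
  assumes h: "hyperbolic K p l1 l2 l3 l4"
  shows "\<exists>l1 l2 l3 l4 \<alpha>. hyperbolic K p l1 l2 l3 l4 \<and> \<alpha> \<in> fst l1 \<and> fst l1 \<subseteq> {..\<alpha>} \<and>
    fst l2 \<subseteq> {..<\<alpha>} \<and> fst l3 \<subseteq> {..<\<alpha>} \<and> fst l4 \<subseteq> {..<\<alpha>}"
proof -
  define U where "U = fst l1 \<union> fst l2 \<union> fst l3 \<union> fst l4"
  define \<alpha> where "\<alpha> = Max U"
  have fin: "finite U" and ne: "U \<noteq> {}"
    using hyperbolic_finite[OF h] hyperbolic_nonempty[OF h] by (auto simp: U_def)
  have "\<alpha> \<in> U" and "U \<subseteq> {..\<alpha>}" using fin ne Max_in Max_ge by (auto simp: \<alpha>_def)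
  then have mem: "\<alpha> \<in> fst l1 \<or> \<alpha> \<in> fst l2 \<or> \<alpha> \<in> fst l3 \<or> \<alpha> \<in> fst l4"
    and le: "fst l1 \<subseteq> {..\<alpha>}" "fst l2 \<subseteq> {..\<alpha>}" "fst l3 \<subseteq> {..\<alpha>}" "fst l4 \<subseteq> {..\<alpha>}"
    by (auto simp: U_def)
  define ok where "ok l1 l2 l3 l4 \<longleftrightarrow> hyperbolic K p l1 l2 l3 l4 \<and> \<alpha> \<in> fst l1 \<and>
    fst l1 \<subseteq> {..\<alpha>} \<and> fst l2 \<subseteq> {..\<alpha>} \<and> fst l3 \<subseteq> {..\<alpha>} \<and> fst l4 \<subseteq> {..\<alpha>}" for l1 l2 l3 l4
  have "\<exists>l1 l2 l3 l4. ok l1 l2 l3 l4"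
    using mem
  proof (elim disjE)
    assume "\<alpha> \<in> fst l1"
    then have "ok l1 l2 l3 l4" using h le by (simp add: ok_def)
    then show ?thesis by blast
  next
    assume "\<alpha> \<in> fst l2"
    then have "ok l2 l1 l3 l4" using hyperbolic_swap[OF h] le by (simp add: ok_def)
    then show ?thesis by blast
  next
    assume "\<alpha> \<in> fst l3"
    then have "ok l3 l4 l1 l2" using hyperbolic_swap_pairs[OF h] le by (simp add: ok_def)
    then show ?thesis by blast
  next
    assume "\<alpha> \<in> fst l4"
    then have "ok l4 l3 l1 l2"
      using hyperbolic_swap[OF hyperbolic_swap_pairs[OF h]] le by (simp add: ok_def)
    then show ?thesis by blast
  qed
  moreover have "\<exists>l2' l3'. ok l1 l2' l3' l4 \<and> \<alpha> \<notin> fst l3'" if "ok l1 l2 l3 l4" for l1 l2 l3 l4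
  proof (cases "\<alpha> \<in> fst l3")
    case True
    then have "ok l1 (fadd l2 l4) (fadd l3 l1) l4"
      using that hyperbolic_transvection unfolding ok_def by (simp add: sd_subset)
    moreover have "\<alpha> \<notin> fst (fadd l3 l1)" using True that by (simp add: ok_def)
    ultimately show ?thesis by blast
  qed (use that in blast)
  moreover have "\<exists>l2' l4'. ok l1 l2' l3 l4' \<and> \<alpha> \<notin> fst l4'" if "ok l1 l2 l3 l4" for l1 l2 l3 l4
  proof (cases "\<alpha> \<in> fst l4")
    case True
    then have "ok l1 (fadd l2 l3) l3 (fadd l4 l1)"
      using that hyperbolic_transvection' unfolding ok_def by (simp add: sd_subset)
    moreover have "\<alpha> \<notin> fst (fadd l4 l1)" using True that by (simp add: ok_def)
    ultimately show ?thesis by blast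
  qed (use that in blast)
  moreover have "\<exists>l2'. ok l1 l2' l3 l4 \<and> \<alpha> \<notin> fst l2'" if "ok l1 l2 l3 l4" for l1 l2 l3 l4
  proof (cases "\<alpha> \<in> fst l2")
    case True
    then have "ok l1 (fnot (fadd l2 l1)) l3 l4"
      using that hyperbolic_square unfolding ok_def by (simp add: sd_subset)
    moreover have "\<alpha> \<notin> fst (fnot (fadd l2 l1))" using True that by (simp add: ok_def)
    ultimately show ?thesis by blast
  qed (use that in blast)
  ultimately obtain l1 l2 l3 l4 where *: "ok l1 l2 l3 l4" "\<alpha> \<notin> fst l2" "\<alpha> \<notin> fst l3" "\<alpha> \<notin> fst l4"
    by metis
  have lt: "A \<subseteq> {..<\<alpha>}" if "A \<subseteq> {..\<alpha>}" "\<alpha> \<notin> A" for A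
    using that by (metis atMost_iff lessThan_iff order_le_less subset_iff)
  show ?thesis using * lt unfolding ok_def by blast
qed

text \<open>\<open>l2\<close> never changes, so \<beta> remains its leading variable, and whatever
  is added to \<open>l1\<close> lies below \<alpha>. Since each transvection alters
  \<open>l1\<close>, that form is cleared of \<beta> last.\<close>

lemma hyperbolic_leading_second:
  assumes h: "hyperbolic K p l1 l2 l3 l4" and a: "\<alpha> \<in> fst l1" "fst l1 \<subseteq> {..\<alpha>}"
    and lt: "fst l2 \<subseteq> {..<\<alpha>}" "fst l3 \<subseteq> {..<\<alpha>}" "fst l4 \<subseteq> {..<\<alpha>}"
  shows "\<exists>l1 l3 l4 \<beta>. hyperbolic K p l1 l2 l3 l4 \<and> \<alpha> \<in> fst l1 \<and> fst l1 \<subseteq> {..\<alpha>} \<and> \<beta> \<notin> fst l1 \<and>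
    \<beta> < \<alpha> \<and> \<beta> \<in> fst l2 \<and> fst l2 \<subseteq> {..\<beta>} \<and> \<alpha> \<notin> fst l3 \<and> \<alpha> \<notin> fst l4 \<and> \<beta> \<notin> fst l3 \<and> \<beta> \<notin> fst l4"
proof -
  define \<beta> where "\<beta> = Max (fst l2)"
  have "fst l2 \<noteq> {}" "finite (fst l2)"
    using hyperbolic_nonempty[OF hyperbolic_swap[OF h]] hyperbolic_finite[OF h] by auto
  then have b: "\<beta> \<in> fst l2" "fst l2 \<subseteq> {..\<beta>}" using Max_in Max_ge by (auto simp: \<beta>_def)
  then have ba: "\<beta> < \<alpha>" using lt by auto
  define ok where "ok l1 l3 l4 \<longleftrightarrow> hyperbolic K p l1 l2 l3 l4 \<and> \<alpha> \<in> fst l1 \<and>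
    fst l1 \<subseteq> {..\<alpha>} \<and> fst l3 \<subseteq> {..<\<alpha>} \<and> fst l4 \<subseteq> {..<\<alpha>}" for l1 l3 l4
  have le: "A \<subseteq> {..<\<alpha>} \<Longrightarrow> A \<subseteq> {..\<alpha>}" "A \<subseteq> {..<\<alpha>} \<Longrightarrow> \<alpha> \<notin> A" for A by auto
  have "ok l1 l3 l4" using assms by (simp add: ok_def)
  moreover have "\<exists>l1' l3'. ok l1' l3' l4 \<and> \<beta> \<notin> fst l3'" if "ok l1 l3 l4" for l1 l3 l4
  proof (cases "\<beta> \<in> fst l3")
    case True
    have "hyperbolic K p (fadd l1 l4) l2 (fadd l3 l2) l4"
      using that hyperbolic_swap hyperbolic_transvection unfolding ok_def by metis
    then have "ok (fadd l1 l4) (fadd l3 l2) l4"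
      using that lt(1) le unfolding ok_def by (simp add: sd_subset)
    moreover have "\<beta> \<notin> fst (fadd l3 l2)" using True b by simp
    ultimately show ?thesis by blast
  qed (use that in blast)
  moreover have "\<exists>l1' l4'. ok l1' l3 l4' \<and> \<beta> \<notin> fst l4'" if "ok l1 l3 l4" for l1 l3 l4
  proof (cases "\<beta> \<in> fst l4")
    case True
    have "hyperbolic K p (fadd l1 l3) l2 l3 (fadd l4 l2)"
      using that hyperbolic_swap hyperbolic_transvection' unfolding ok_def by metis
    then have "ok (fadd l1 l3) l3 (fadd l4 l2)"
      using that lt(1) le unfolding ok_def by (simp add: sd_subset)
    moreover have "\<beta> \<notin> fst (fadd l4 l2)" using True b by simp
    ultimately show ?thesis by blast
  qed (use that in blast)
  moreover have "\<exists>l1'. ok l1' l3 l4 \<and> \<beta> \<notin> fst l1'" if "ok l1 l3 l4" for l1 l3 l4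
  proof (cases "\<beta> \<in> fst l1")
    case True
    have "hyperbolic K p (fnot (fadd l1 l2)) l2 l3 l4"
      using that hyperbolic_swap hyperbolic_square unfolding ok_def by metis
    then have "ok (fnot (fadd l1 l2)) l3 l4"
      using that lt(1) le unfolding ok_def by (simp add: sd_subset)
    moreover have "\<beta> \<notin> fst (fnot (fadd l1 l2))" using True b by simp
    ultimately show ?thesis by blast
  qed (use that in blast)
  ultimately obtain l1 l3 l4 where "ok l1 l3 l4" "\<beta> \<notin> fst l1" "\<beta> \<notin> fst l3" "\<beta> \<notin> fst l4"
    by metis
  then show ?thesis using b ba le(2) unfolding ok_def by blast
qed

text \<open>Only swaps and square moves within the second pair are used, so the first pair is
  untouched and the variables stay inside N. The set N is there to carry the absence of \<alpha> and
  \<beta>.\<close>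

lemma hyperbolic_leading_last:
  assumes h: "hyperbolic K p l1 l2 l3 l4" and N: "fst l3 \<subseteq> N" "fst l4 \<subseteq> N"
  shows "\<exists>l3 l4 \<gamma> \<delta>. hyperbolic K p l1 l2 l3 l4 \<and> fst l3 \<subseteq> N \<and> fst l4 \<subseteq> N \<and>
    \<gamma> \<in> fst l3 \<and> fst l3 \<subseteq> {..\<gamma>} \<and> \<delta> \<notin> fst l3 \<and> \<delta> < \<gamma> \<and> \<delta> \<in> fst l4 \<and> fst l4 \<subseteq> {..\<delta>}"
proof -
  have swap: "hyperbolic K p l1 l2 l4 l3" if "hyperbolic K p l1 l2 l3 l4" for l3 l4
    using that hyperbolic_swap hyperbolic_swap_pairs by metis
  have square: "hyperbolic K p l1 l2 l3 (fnot (fadd l4 l3))" if "hyperbolic K p l1 l2 l3 l4" for l3 l4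
    using that hyperbolic_square hyperbolic_swap_pairs by metis
  have top: "\<exists>x. x \<in> A \<and> A \<subseteq> {..x}" if "finite A" "A \<noteq> {}" for A :: "nat set"
    using Max_in[OF that] Max_ge[OF that(1)] by (intro exI[of _ "Max A"]) auto
  define U where "U = fst l3 \<union> fst l4"
  have "finite U" "U \<noteq> {}"
    using hyperbolic_finite[OF h] hyperbolic_nonempty[OF hyperbolic_swap_pairs[OF h]] by (auto simp: U_def)
  then obtain \<gamma> where g: "\<gamma> \<in> U" "U \<subseteq> {..\<gamma>}" using top by blast
  define ok where "ok l3 l4 \<longleftrightarrow> hyperbolic K p l1 l2 l3 l4 \<and> fst l3 \<subseteq> N \<and> fst l4 \<subseteq> N \<and>
    \<gamma> \<in> fst l3 \<and> fst l3 \<subseteq> {..\<gamma>} \<and> fst l4 \<subseteq> {..\<gamma>}" for l3 l4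
  have "ok l3 l4 \<or> ok l4 l3" using g h swap[OF h] N by (auto simp: ok_def U_def)
  then obtain k3 k4 where "ok k3 k4" by blast
  then obtain k4 where k4: "ok k3 k4" "\<gamma> \<notin> fst k4"
  proof (cases "\<gamma> \<in> fst k4")
    case True
    have "ok k3 (fnot (fadd k4 k3))"
      using \<open>ok k3 k4\<close> square unfolding ok_def by (simp add: sd_subset)
    moreover have "\<gamma> \<notin> fst (fnot (fadd k4 k3))" using True \<open>ok k3 k4\<close> by (simp add: ok_def)
    ultimately show ?thesis using that by blast
  qed blast
  have "fst k4 \<noteq> {}" "finite (fst k4)"
    using k4 hyperbolic_nonempty hyperbolic_finite swap hyperbolic_swap_pairs unfolding ok_def by metis+
  then obtain \<delta> where dl: "\<delta> \<in> fst k4" "fst k4 \<subseteq> {..\<delta>}" using top by blast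
  have lt: "\<delta> < \<gamma>" using dl k4 unfolding ok_def by (metis atMost_iff order_le_less subset_iff)
  show ?thesis
  proof (cases "\<delta> \<in> fst k3")
    case False
    then show ?thesis using k4 dl lt unfolding ok_def by blast
  next
    case True
    let ?k3 = "fnot (fadd k3 k4)"
    have "hyperbolic K p l1 l2 ?k3 k4" using k4 swap square unfolding ok_def by metis
    moreover have "fst ?k3 \<subseteq> N" "fst ?k3 \<subseteq> {..\<gamma>}" "\<gamma> \<in> fst ?k3" "\<delta> \<notin> fst ?k3"
      using k4 True dl unfolding ok_def by (simp_all add: sd_subset)
    ultimately show ?thesis using k4 dl lt unfolding ok_def by blast
  qed
qed

text \<open>Leading variables make each form the image of a variable under a lower triangular map;
  \<open>\<beta> \<notin> fst l1\<close> and \<open>\<delta> \<notin> fst l3\<close> meet the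
  zero-column condition of \<open>is_lta_g\<close>. Nothing keeps \<gamma> and \<delta> out of the
  first pair.\<close>

lemma hyperbolic_normal_form:
  assumes "hyperbolic K p l1 l2 l3 l4"
  shows "\<exists>l1 l2 l3 l4 \<alpha> \<beta> \<gamma> \<delta>. hyperbolic K p l1 l2 l3 l4 \<and>
    \<alpha> \<in> fst l1 \<and> fst l1 \<subseteq> {..\<alpha>} \<and> \<beta> \<notin> fst l1 \<and> \<beta> < \<alpha> \<and> \<beta> \<in> fst l2 \<and> fst l2 \<subseteq> {..\<beta>} \<and>
    \<gamma> \<in> fst l3 \<and> fst l3 \<subseteq> {..\<gamma>} \<and> \<delta> \<notin> fst l3 \<and> \<delta> < \<gamma> \<and> \<delta> \<in> fst l4 \<and> fst l4 \<subseteq> {..\<delta>} \<and>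
    \<alpha> \<notin> fst l3 \<and> \<alpha> \<notin> fst l4 \<and> \<beta> \<notin> fst l3 \<and> \<beta> \<notin> fst l4"
proof -
  from hyperbolic_leading_first[OF assms] obtain l1 l2 l3 l4 \<alpha> where
    1: "hyperbolic K p l1 l2 l3 l4" "\<alpha> \<in> fst l1" "fst l1 \<subseteq> {..\<alpha>}"
    "fst l2 \<subseteq> {..<\<alpha>}" "fst l3 \<subseteq> {..<\<alpha>}" "fst l4 \<subseteq> {..<\<alpha>}" by blast
  from hyperbolic_leading_second[OF 1] obtain l1 l3 l4 \<beta> where
    2: "hyperbolic K p l1 l2 l3 l4" "\<alpha> \<in> fst l1" "fst l1 \<subseteq> {..\<alpha>}" "\<beta> \<notin> fst l1" "\<beta> < \<alpha>" "\<beta> \<in> fst l2"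
    "fst l2 \<subseteq> {..\<beta>}" "\<alpha> \<notin> fst l3" "\<alpha> \<notin> fst l4" "\<beta> \<notin> fst l3" "\<beta> \<notin> fst l4" by blast
  then have "fst l3 \<subseteq> - {\<alpha>, \<beta>}" "fst l4 \<subseteq> - {\<alpha>, \<beta>}" by auto
  from hyperbolic_leading_last[OF 2(1) this] obtain l3 l4 \<gamma> \<delta> where
    3: "hyperbolic K p l1 l2 l3 l4" "fst l3 \<subseteq> - {\<alpha>, \<beta>}" "fst l4 \<subseteq> - {\<alpha>, \<beta>}"
    "\<gamma> \<in> fst l3" "fst l3 \<subseteq> {..\<gamma>}" "\<delta> \<notin> fst l3" "\<delta> < \<gamma>" "\<delta> \<in> fst l4" "fst l4 \<subseteq> {..\<delta>}" by blast
  have "\<alpha> \<notin> fst l3 \<and> \<alpha> \<notin> fst l4 \<and> \<beta> \<notin> fst l3 \<and> \<beta> \<notin> fst l4" using 3(2,3) by blast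
  then show ?thesis using 2(2-7) 3 by blast
qed

subsection \<open>Evaluation and coefficients of polynomials\<close>

lemma padd_eq: "padd P Q = P \<triangle> Q"
  by (auto simp: padd_def)

lemma peval_singleton: "peval {T} X \<longleftrightarrow> T \<subseteq> X"
proof -
  have "{S \<in> {T}. S \<subseteq> X} = (if T \<subseteq> X then {T} else {})" by auto
  then show ?thesis by (simp add: peval_def)
qed

lemma peval_empty: "\<not> peval {} X"
  by (simp add: peval_def)

lemma peval_sd:
  assumes "finite P" "finite Q"
  shows "peval (P \<triangle> Q) X \<longleftrightarrow> peval P X \<noteq> peval Q X"
proof -
  have "{S \<in> P \<triangle> Q. S \<subseteq> X} = {S \<in> P. S \<subseteq> X} \<triangle> {S \<in> Q. S \<subseteq> X}" by auto
  then show ?thesis using assms by (simp add: peval_def even_card_sd)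
qed

lemma peval_insert:
  assumes "finite P" "T \<notin> P"
  shows "peval (insert T P) X \<longleftrightarrow> (T \<subseteq> X) \<noteq> peval P X"
proof -
  have "insert T P = {T} \<triangle> P" using assms(2) by auto
  then show ?thesis using assms(1) by (simp only: peval_sd peval_singleton finite.intros)
qed

lemma even_card_supersets:
  assumes "finite S"
  shows "even (card {X \<in> Pow S. T \<subseteq> X}) \<longleftrightarrow> T \<noteq> S"
proof (cases "T \<subseteq> S")
  case True
  have "bij_betw (\<lambda>Y. T \<union> Y) (Pow (S - T)) {X \<in> Pow S. T \<subseteq> X}"
    by (rule bij_betw_byWitness[where f' = "\<lambda>X. X - T"]) (use True in auto)
  then have "card {X \<in> Pow S. T \<subseteq> X} = 2 ^ card (S - T)"
    using bij_betw_same_card assms by (fastforce simp: card_Pow)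
  moreover have "card (S - T) = 0 \<longleftrightarrow> T = S" using assms True by auto
  ultimately show ?thesis by (cases "T = S") simp_all
next
  case False
  then have "{X \<in> Pow S. T \<subseteq> X} = {}" by auto
  then show ?thesis using False by (metis card.empty even_zero order_refl)
qed

text \<open>Both sides are additive in P, so a single monomial T suffices: the number of X between T
  and S is odd only for T = S.\<close>

lemma moebius_inversion:
  assumes "finite P" "finite S"
  shows "S \<in> P \<longleftrightarrow> odd (card {X \<in> Pow S. peval P X})"
  using assms(1)
proof (induction P rule: finite_induct)
  case (insert T P)
  have "{X \<in> Pow S. peval (insert T P) X} = {X \<in> Pow S. T \<subseteq> X} \<triangle> {X \<in> Pow S. peval P X}"
    using insert(1,2) by (auto simp: peval_insert)
  then have "odd (card {X \<in> Pow S. peval (insert T P) X}) \<longleftrightarrow> (T = S) \<noteq> (S \<in> P)"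
    using even_card_supersets[OF assms(2), of T] insert.IH assms(2) by (simp add: even_card_sd)
  then show ?case using insert(2) by auto
qed (simp add: peval_empty)

lemma peval_ext:
  assumes "P \<in> Rm m" "Q \<in> Rm m" "\<And>X. X \<subseteq> {..<m} \<Longrightarrow> peval P X \<longleftrightarrow> peval Q X"
  shows "P = Q"
proof -
  have fin: "finite P" "finite Q" using assms(1,2) by (auto simp: Rm_def intro: finite_family)
  have "S \<in> P \<longleftrightarrow> S \<in> Q" if S: "S \<subseteq> {..<m}" for S
  proof -
    have "finite S" using S finite_subset by auto
    moreover have "{X \<in> Pow S. peval P X} = {X \<in> Pow S. peval Q X}" using assms(3) S by blast
    ultimately show ?thesis using moebius_inversion fin by simp
  qed
  then show ?thesis using assms(1,2) unfolding Rm_def by blast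
qed

text \<open>The link from the degree of monomials to \<open>degle\<close>: a monomial is a product
  of coordinate forms.\<close>

lemma degle_peval:
  assumes "finite P" "\<And>T. T \<in> P \<Longrightarrow> T \<subseteq> {..<m} \<and> card T \<le> r"
  shows "degle m r {X \<in> Pow {..<m}. peval P X}"
  using assms
proof (induction P rule: finite_induct)
  case (insert T P)
  have T: "T \<subseteq> {..<m}" "card T \<le> r" using insert.prems by auto
  have "degle m (card T) {X \<in> Pow {..<m}. \<forall>i\<in>T. aff {i} False X}"
    by (rule degle_aff_all) (use T finite_subset in auto)
  moreover have "{X \<in> Pow {..<m}. \<forall>i\<in>T. aff {i} False X} = {X \<in> Pow {..<m}. T \<subseteq> X}"
    by (auto simp: aff_singleton)
  ultimately have "degle m r {X \<in> Pow {..<m}. T \<subseteq> X}" using degle_mono[OF T(2)] by simp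
  moreover have "degle m r {X \<in> Pow {..<m}. peval P X}" using insert by simp
  moreover have "{X \<in> Pow {..<m}. peval (insert T P) X} =
      {X \<in> Pow {..<m}. T \<subseteq> X} \<triangle> {X \<in> Pow {..<m}. peval P X}"
    using insert(1,2) by (auto simp: peval_insert)
  ultimately show ?case using degle_sd by simp
qed (simp add: peval_empty degle_empty)

text \<open>A formal sum of monomials \<open>g d\<close> with repetitions, collected mod 2, still
  evaluates to the parity of its terms. With a product set for D this yields the evaluation of
  \<open>pmul\<close>.\<close>

lemma peval_parity_image:
  assumes "finite D"
  shows "finite {S. odd (card {d \<in> D. g d = S})} \<and>
    peval {S. odd (card {d \<in> D. g d = S})} X = odd (card {d \<in> D. g d \<subseteq> X})"
  using assms
proof (induction D rule: finite_induct)
  case (insert d D)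
  let ?N = "\<lambda>D. {S. odd (card {d \<in> D. g d = S})}"
  have split: "{x \<in> insert d D. Q x} = (if Q d then {d} else {}) \<triangle> {x \<in> D. Q x}" for Q
    using insert(2) by auto
  have "?N (insert d D) = {g d} \<triangle> ?N D"
    unfolding split using insert(1) by (auto simp: even_card_sd)
  moreover have "odd (card {x \<in> insert d D. g x \<subseteq> X}) \<longleftrightarrow> (g d \<subseteq> X) \<noteq> odd (card {x \<in> D. g x \<subseteq> X})"
    unfolding split using insert(1) by (simp add: even_card_sd)
  ultimately show ?case using insert.IH by (simp add: peval_sd peval_singleton)
qed (simp add: peval_empty)

lemma pmul_eq: "pmul P Q = {S. odd (card {d \<in> P \<times> Q. fst d \<union> snd d = S})}"
  unfolding pmul_def by (intro Collect_cong arg_cong[where f = "\<lambda>A. odd (card A)"]) auto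

lemma finite_pmul: "finite P \<Longrightarrow> finite Q \<Longrightarrow> finite (pmul P Q)"
  using peval_parity_image[of "P \<times> Q" "\<lambda>d. fst d \<union> snd d"] by (simp add: pmul_eq)

lemma peval_pmul:
  assumes "finite P" "finite Q"
  shows "peval (pmul P Q) X \<longleftrightarrow> peval P X \<and> peval Q X"
proof -
  have "{d \<in> P \<times> Q. fst d \<union> snd d \<subseteq> X} = {S \<in> P. S \<subseteq> X} \<times> {S \<in> Q. S \<subseteq> X}" by auto
  then show ?thesis
    using peval_parity_image[of "P \<times> Q" "\<lambda>d. fst d \<union> snd d" X] assms
    by (simp add: pmul_eq card_cartesian_product peval_def)
qed

lemma pmul_subset:
  assumes "P \<subseteq> Pow A" "Q \<subseteq> Pow A"
  shows "pmul P Q \<subseteq> Pow A"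
proof
  fix S assume "S \<in> pmul P Q"
  then have "odd (card {d \<in> P \<times> Q. fst d \<union> snd d = S})" by (simp add: pmul_eq)
  then obtain d where "d \<in> P \<times> Q" "fst d \<union> snd d = S"
    by (metis (mono_tags, lifting) Collect_empty_eq card.empty even_zero)
  moreover from this have "fst d \<in> Pow A" "snd d \<in> Pow A"
    using assms unfolding mem_Times_iff by blast+
  ultimately show "S \<in> Pow A" by blast
qed

lemma pprod_list:
  assumes "\<And>P. P \<in> set Ps \<Longrightarrow> finite P"
  shows "finite (pprod_list Ps) \<and> (peval (pprod_list Ps) X \<longleftrightarrow> (\<forall>P \<in> set Ps. peval P X))"
  using assms
proof (induction Ps)
  case Nil
  show ?case by (simp add: pprod_list_def pone_def peval_singleton)
next
  case (Cons P Ps)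
  then have "finite (pprod_list Ps) \<and> (peval (pprod_list Ps) X \<longleftrightarrow> (\<forall>P \<in> set Ps. peval P X))" by simp
  moreover have "pprod_list (P # Ps) = pmul P (pprod_list Ps)" by (simp add: pprod_list_def)
  ultimately show ?case using Cons.prems by (simp add: finite_pmul peval_pmul)
qed

lemma pprod_list_subset: "(\<And>P. P \<in> set Ps \<Longrightarrow> P \<subseteq> Pow A) \<Longrightarrow> pprod_list Ps \<subseteq> Pow A"
  by (induction Ps) (simp_all add: pprod_list_def pone_def pmul_subset)

section \<open>The group action as substitution\<close>

lemma lin_img_eq:
  "lin_img b e i = (\<lambda>j. {j}) ` insert i {j. j < i \<and> b i j} \<union> (if e i then {{}} else {})"
  by (auto simp: lin_img_def)

lemma finite_lin_img: "finite (lin_img b e i)"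
  by (simp add: lin_img_eq)

lemma peval_lin_img: "peval (lin_img b e i) X \<longleftrightarrow> aff (insert i {j. j < i \<and> b i j}) (e i) X"
proof -
  let ?A = "insert i {j. j < i \<and> b i j}"
  have "{S \<in> lin_img b e i. S \<subseteq> X} = (\<lambda>j. {j}) ` (?A \<inter> X) \<union> (if e i then {{}} else {})"
    by (auto simp: lin_img_eq)
  moreover have "card ((\<lambda>j. {j}) ` (?A \<inter> X)) = card (?A \<inter> X)" by (rule card_image) simp
  moreover have "finite ((\<lambda>j. {j}) ` (?A \<inter> X))" "{} \<notin> (\<lambda>j. {j}) ` (?A \<inter> X)" by auto
  ultimately show ?thesis by (simp add: peval_def aff_def)
qed

lemma act_mono:
  assumes "finite f"
  shows "finite (act_mono b e f)" "peval (act_mono b e f) X \<longleftrightarrow> f \<subseteq> {i. peval (lin_img b e i) X}"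
  using pprod_list[of "map (lin_img b e) (sorted_list_of_set f)" X] finite_lin_img assms
  by (auto simp: act_mono_def)

text \<open>Acting on P amounts to moving the point: its new i-th coordinate is the value at X of
  the image of x_i. Identities about orbits thus become pointwise, and \<open>peval_ext\<close>
  turns them back into equalities of polynomials.\<close>

lemma act_poly:
  assumes "finite P" "\<And>f. f \<in> P \<Longrightarrow> finite f"
  shows "finite (act_poly b e P) \<and> peval (act_poly b e P) X = peval P {i. peval (lin_img b e i) X}"
  using assms
proof (induction P rule: finite_induct)
  case (insert f P)
  have "{g \<in> insert f P. S \<in> act_mono b e g} =
      (if S \<in> act_mono b e f then {f} else {}) \<triangle> {g \<in> P. S \<in> act_mono b e g}" for S
    using insert(2) by auto
  then have "act_poly b e (insert f P) = act_mono b e f \<triangle> act_poly b e P"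
    using insert(1) unfolding act_poly_def by (auto simp: even_card_sd)
  then show ?case
    using insert act_mono[of f] by (simp add: peval_insert peval_sd)
qed (simp add: act_poly_def peval_empty)

lemma act_poly_Rm:
  assumes "P \<in> Rm m" "is_lta m b e"
  shows "act_poly b e P \<in> Rm m"
proof -
  have "lin_img b e i \<subseteq> Pow {..<m}" if "i < m" for i
    using that by (auto simp: lin_img_def)
  then have mono: "act_mono b e f \<subseteq> Pow {..<m}" if "f \<in> P" for f
  proof -
    have "finite f" "f \<subseteq> {..<m}" using assms(1) that finite_subset[of f "{..<m}"] by (auto simp: Rm_def)
    then show ?thesis unfolding act_mono_def
      using \<open>\<And>i. i < m \<Longrightarrow> lin_img b e i \<subseteq> Pow {..<m}\<close> by (intro pprod_list_subset) auto
  qed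
  have "S \<in> Pow {..<m}" if "S \<in> act_poly b e P" for S
  proof -
    have "{f \<in> P. S \<in> act_mono b e f} \<noteq> {}"
      using that by (metis (mono_tags, lifting) act_poly_def card.empty even_zero mem_Collect_eq)
    then show ?thesis using mono by blast
  qed
  then show ?thesis unfolding Rm_def by blast
qed

text \<open>The one delicate case is x \<le> a < y: x heads the first list and a the second. As
  putting a in front of \<open>xs\<close> is inserting it, the tails compare by induction with a in
  the role of x.\<close>

lemma insort_list_all2:
  "x \<le> y \<Longrightarrow> sorted xs \<Longrightarrow> list_all2 (\<le>) (insort x xs) (insort (y::nat) xs)"
proof (induction xs arbitrary: x)
  case (Cons a xs)
  show ?case
  proof (cases "x \<le> a \<and> \<not> y \<le> a")
    case True
    have "insort a xs = a # xs" using Cons.prems by (simp add: insort_is_Cons)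
    then have "list_all2 (\<le>) (a # xs) (insort y xs)" using Cons.IH[of a] Cons.prems True by simp
    then show ?thesis using True by simp
  next
    case False
    then show ?thesis using Cons by (auto simp: list_all2_refl)
  qed
qed simp

lemma mono_le_replace:
  assumes "finite R" "x \<le> y" "x \<notin> R" "y \<notin> R"
  shows "mono_le (insert x R) (insert y R)"
proof -
  have "list_all2 (\<le>) (insort x (sorted_list_of_set R)) (insort y (sorted_list_of_set R))"
    using assms by (intro insort_list_all2) auto
  then have "list_all2 (\<le>) (sorted_list_of_set (insert x R)) (sorted_list_of_set (insert y R))"
    using assms by (simp add: sorted_list_of_set_insert_remove)
  then have "sh_le (insert x R) (insert y R)"
    using assms unfolding sh_le_def by (auto simp: list_all2_conv_all_nth)
  then show ?thesis unfolding mono_le_def by blast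
qed

subsection \<open>Independence of the affine forms\<close>

text \<open>All fibres of an affine map have at most as many points as any nonempty one.\<close>

lemma affine_map_surj:
  assumes K: "finite K" and a: "a1 \<subseteq> K" "a2 \<subseteq> K" "a3 \<subseteq> K" "a4 \<subseteq> K"
    and card: "16 * card {X. X \<subseteq> K \<and> aff a1 c1 X \<and> aff a2 c2 X \<and> aff a3 c3 X \<and> aff a4 c4 X} = 2 ^ card K"
  shows "\<exists>X \<subseteq> K. aff a1 c1 X = b1 \<and> aff a2 c2 X = b2 \<and> aff a3 c3 X = b3 \<and> aff a4 c4 X = b4"
proof -
  define \<Phi> where "\<Phi> X = (aff a1 c1 X, aff a2 c2 X, aff a3 c3 X, aff a4 c4 X)" for X
  define N where "N z = {X \<in> Pow K. \<Phi> X = z}" for z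
  let ?t = "(True, True, True, True)"
  have fin: "finite a1" "finite a2" "finite a3" "finite a4" using a K finite_subset by blast+
  have "N ?t = {X. X \<subseteq> K \<and> aff a1 c1 X \<and> aff a2 c2 X \<and> aff a3 c3 X \<and> aff a4 c4 X}"
    by (auto simp: N_def \<Phi>_def)
  then have card_t: "16 * card (N ?t) = 2 ^ card K" using card by simp
  have finN: "finite (N z)" for z using K by (simp add: N_def)
  have "card (N ?t) \<noteq> 0" using card_t by (metis mult_0_right power_not_zero zero_neq_numeral)
  then obtain p where p: "p \<in> N ?t" by fastforce
  have le: "card (N z) \<le> card (N ?t)" for z
  proof (cases "N z = {}")
    case False
    then obtain y where y: "y \<in> N z" by blast
    \<comment> \<open>Translation by p + y carries the fibre of y into the fibre of p.\<close>
    have "shift (p \<triangle> y) (N z) \<subseteq> N ?t"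
    proof
      fix X assume "X \<in> shift (p \<triangle> y) (N z)"
      then have W: "p \<triangle> (y \<triangle> X) \<in> N z" by (simp add: sd_assoc)
      have X: "X = p \<triangle> (y \<triangle> (p \<triangle> (y \<triangle> X)))" by (metis sd_cancel sd_left_commute)
      have sub: "p \<subseteq> K" "y \<subseteq> K" "p \<triangle> (y \<triangle> X) \<subseteq> K" using p y W by (simp_all add: N_def)
      have "p \<triangle> (y \<triangle> (p \<triangle> (y \<triangle> X))) \<subseteq> K"
        by (rule sd_subset[OF sub(1) sd_subset[OF sub(2,3)]])
      then have "X \<subseteq> K" unfolding X[symmetric] .
      moreover have "aff a c X" if "finite a" "aff a c p" "aff a c y \<longleftrightarrow> aff a c (p \<triangle> (y \<triangle> X))" for a c
        using that aff_sd3[OF that(1), of c p y X] by blast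
      then have "\<Phi> X = ?t" using p y W fin unfolding N_def \<Phi>_def by auto
      ultimately show "X \<in> N ?t" by (simp add: N_def)
    qed
    then show ?thesis using card_mono[OF finN] by (metis card_shift)
  qed simp
  \<comment> \<open>Pigeonhole: the 16 |N ?t| points of the cube lie in fibres of at most |N ?t|
    points each, so all sixteen values occur.\<close>
  have "card (Pow K) = (\<Sum>X\<in>Pow K. 1)" by simp
  also have "\<dots> = (\<Sum>z\<in>\<Phi> ` Pow K. \<Sum>X\<in>{X \<in> Pow K. \<Phi> X = z}. 1)"
    using K by (intro sum.image_gen) simp
  also have "\<dots> = (\<Sum>z\<in>\<Phi> ` Pow K. card (N z))" by (simp add: N_def)
  also have "\<dots> \<le> card (\<Phi> ` Pow K) * card (N ?t)"
    using sum_bounded_above[of "\<Phi> ` Pow K" "\<lambda>z. card (N z)" "card (N ?t)"] le by simp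
  finally have "16 * card (N ?t) \<le> card (\<Phi> ` Pow K) * card (N ?t)"
    using K card_t by (simp add: card_Pow)
  then have "16 \<le> card (\<Phi> ` Pow K)" using \<open>card (N ?t) \<noteq> 0\<close> by simp
  moreover have "card (UNIV :: (bool \<times> bool \<times> bool \<times> bool) set) = 16"
    by (simp add: UNIV_bool flip: UNIV_Times_UNIV)
  ultimately have "\<Phi> ` Pow K = UNIV" by (intro card_seteq) auto
  then have "(b1, b2, b3, b4) \<in> \<Phi> ` Pow K" by simp
  then show ?thesis by (auto simp: \<Phi>_def)
qed

lemma exists_form_of_aff_ext:
  assumes e: "echelon m h L" and a: "a \<subseteq> {..<m}"
  shows "\<exists>l. fst l \<subseteq> {..<m} - h \<and> (\<forall>Y \<subseteq> {..<m} - h. aff a c (ext h L d Y) \<longleftrightarrow> fapp l Y)"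
proof -
  have fin: "finite a" using a finite_subset by auto
  obtain a' c' where "a' \<subseteq> {..<m} - h" "\<And>Y. Y \<subseteq> {..<m} - h \<Longrightarrow> aff a c (ext h L d Y) \<longleftrightarrow> aff a' c' Y"
    by (rule affine_function_aff[of "{..<m} - h" "\<lambda>Y. aff a c (ext h L d Y)"])
      (simp_all add: ext_sd3[OF e] aff_sd3[OF fin])
  then show ?thesis by (intro exI[of _ "(a', c')"]) (simp add: fapp_def)
qed

text \<open>Moves the description of S to the free coordinates of T, which satisfy no relations;
  there the one-sixteenth fibre becomes joint surjectivity.\<close>

lemma three_halves_hyperbolic:
  assumes d: "degle m r S" and w: "2 * (2 ^ r * card S) = 3 * 2 ^ m"
  shows "\<exists>h L c l1 l2 l3 l4. echelon m h L \<and> card h + 2 = r \<and> S \<subseteq> ech m h L c \<and>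
    hyperbolic ({..<m} - h) (\<lambda>Y. ext h L c Y \<in> S) l1 l2 l3 l4"
proof -
  from three_halves_structure[OF d w] obtain k T a1 c1 a2 c2 a3 c3 a4 c4 where
    r: "r = Suc (Suc k)" and T: "flat T" "T \<subseteq> Pow {..<m}" "2 ^ k * card T = 2 ^ m"
    and a: "a1 \<subseteq> {..<m}" "a2 \<subseteq> {..<m}" "a3 \<subseteq> {..<m}" "a4 \<subseteq> {..<m}"
    and S: "S = {X \<in> T. (aff a1 c1 X \<and> aff a2 c2 X) \<noteq> (aff a3 c3 X \<and> aff a4 c4 X)}"
    and c16: "16 * card {X \<in> T. aff a1 c1 X \<and> aff a2 c2 X \<and> aff a3 c3 X \<and> aff a4 c4 X} = card T"
    by (elim exE conjE)
  obtain h L c where e: "echelon m h L" and Th: "T = ech m h L c"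
    using flat_echelon[OF T(1,2)] by blast
  have "card T \<noteq> 0" using T(3) by (metis mult_0_right power_not_zero zero_neq_numeral)
  moreover have "2 ^ card h * card T = 2 ^ k * card T" using card_ech[OF e] Th T(3) by simp
  ultimately have k: "card h = k" by simp
  let ?K = "{..<m} - h"
  from exists_form_of_aff_ext[OF e a(1), of c1 c] obtain l1 where
    l1: "fst l1 \<subseteq> ?K" "\<And>Y. Y \<subseteq> ?K \<Longrightarrow> aff a1 c1 (ext h L c Y) \<longleftrightarrow> fapp l1 Y" by blast
  from exists_form_of_aff_ext[OF e a(2), of c2 c] obtain l2 where
    l2: "fst l2 \<subseteq> ?K" "\<And>Y. Y \<subseteq> ?K \<Longrightarrow> aff a2 c2 (ext h L c Y) \<longleftrightarrow> fapp l2 Y" by blast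
  from exists_form_of_aff_ext[OF e a(3), of c3 c] obtain l3 where
    l3: "fst l3 \<subseteq> ?K" "\<And>Y. Y \<subseteq> ?K \<Longrightarrow> aff a3 c3 (ext h L c Y) \<longleftrightarrow> fapp l3 Y" by blast
  from exists_form_of_aff_ext[OF e a(4), of c4 c] obtain l4 where
    l4: "fst l4 \<subseteq> ?K" "\<And>Y. Y \<subseteq> ?K \<Longrightarrow> aff a4 c4 (ext h L c Y) \<longleftrightarrow> fapp l4 Y" by blast
  note ext_T = ext_in_ech[OF e, of _ c, folded Th]
  have "card T = card (Pow ?K)"
    using bij_betw_same_card[OF bij_betw_ech[OF e, of c]] Th by simp
  then have cT: "card T = 2 ^ card ?K" by (simp add: card_Pow)
  have "bij_betw (ext h L c) {Y. Y \<subseteq> ?K \<and> fapp l1 Y \<and> fapp l2 Y \<and> fapp l3 Y \<and> fapp l4 Y}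
      {X \<in> T. aff a1 c1 X \<and> aff a2 c2 X \<and> aff a3 c3 X \<and> aff a4 c4 X}"
  proof (rule bij_betw_byWitness[where f' = "\<lambda>X. X - h"])
    have XK: "X - h \<subseteq> ?K" "ext h L c (X - h) = X" if "X \<in> T" for X
      using that ech_Diff_subset ext_ech[OF e] unfolding Th by blast+
    show "(\<lambda>X. X - h) ` {X \<in> T. aff a1 c1 X \<and> aff a2 c2 X \<and> aff a3 c3 X \<and> aff a4 c4 X}
        \<subseteq> {Y. Y \<subseteq> ?K \<and> fapp l1 Y \<and> fapp l2 Y \<and> fapp l3 Y \<and> fapp l4 Y}"
      using XK l1(2)[OF XK(1)] l2(2)[OF XK(1)] l3(2)[OF XK(1)] l4(2)[OF XK(1)] by fastforce
    show "\<forall>X \<in> {X \<in> T. aff a1 c1 X \<and> aff a2 c2 X \<and> aff a3 c3 X \<and> aff a4 c4 X}. ext h L c (X - h) = X"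
      using XK by simp
    show "\<forall>Y \<in> {Y. Y \<subseteq> ?K \<and> fapp l1 Y \<and> fapp l2 Y \<and> fapp l3 Y \<and> fapp l4 Y}. ext h L c Y - h = Y"
      using ext_Diff by blast
  qed (auto simp: ext_T l1(2) l2(2) l3(2) l4(2))
  from bij_betw_same_card[OF this]
  have "16 * card {Y. Y \<subseteq> ?K \<and> fapp l1 Y \<and> fapp l2 Y \<and> fapp l3 Y \<and> fapp l4 Y} = 2 ^ card ?K"
    using c16 cT by simp
  then have surj: "\<exists>X \<subseteq> ?K. fapp l1 X = b1 \<and> fapp l2 X = b2 \<and> fapp l3 X = b3 \<and> fapp l4 X = b4" for b1 b2 b3 b4
    unfolding fapp_def by (intro affine_map_surj) (simp_all add: l1(1) l2(1) l3(1) l4(1))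
  have "hyperbolic ?K (\<lambda>Y. ext h L c Y \<in> S) l1 l2 l3 l4"
  proof (rule hyperbolicI)
    show "ext h L c X \<in> S \<longleftrightarrow> (fapp l1 X \<and> fapp l2 X) \<noteq> (fapp l3 X \<and> fapp l4 X)" if "X \<subseteq> ?K" for X
      using ext_T[OF that] l1(2)[OF that] l2(2)[OF that] l3(2)[OF that] l4(2)[OF that] by (simp add: S)
  qed (simp_all add: l1(1) l2(1) l3(1) l4(1) surj)
  moreover have "S \<subseteq> ech m h L c" using S Th by auto
  moreover have "card h + 2 = r" using k r by simp
  ultimately show ?thesis using e by blast
qed

text \<open>The map sends x_\<alpha> and x_\<beta> to the two forms and fixes every other variable.
  Its columns in \<open>h \<union> {\<alpha>, \<beta>}\<close> vanish because the forms avoid h,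
  \<beta> is not in \<open>l1\<close>, and \<beta> < \<alpha> keeps \<alpha> out of
  \<open>l2\<close>.\<close>

lemma monomial_pair_orbit:
  assumes "\<alpha> < m" "\<beta> < m" "h \<subseteq> {..<m}" "fst l1 \<inter> h = {}" "fst l2 \<inter> h = {}"
    and l1: "\<alpha> \<in> fst l1" "fst l1 \<subseteq> {..\<alpha>}" "\<beta> \<notin> fst l1"
    and l2: "\<beta> \<in> fst l2" "fst l2 \<subseteq> {..\<beta>}" "\<beta> < \<alpha>"
  shows "\<exists>Q \<in> orbit_g m (h \<union> {\<alpha>, \<beta>}) {{{\<alpha>, \<beta>}}}. Q \<in> Rm m \<and>
    (\<forall>X. peval Q X \<longleftrightarrow> fapp l1 X \<and> fapp l2 X)"
proof -
  define b where "b i j \<longleftrightarrow> i = \<alpha> \<and> j \<in> fst l1 - {\<alpha>} \<or> i = \<beta> \<and> j \<in> fst l2 - {\<beta>}" for i j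
  define e where "e i \<longleftrightarrow> i = \<alpha> \<and> snd l1 \<or> i = \<beta> \<and> snd l2" for i
  have lt: "j < \<alpha>" if "j \<in> fst l1 - {\<alpha>}" for j using that l1(2) by (auto simp: order_less_le)
  have lt': "j < \<beta>" if "j \<in> fst l2 - {\<beta>}" for j using that l2(2) by (auto simp: order_less_le)
  have lta: "is_lta m b e"
    unfolding is_lta_def b_def e_def using lt lt' assms(1,2) by blast
  have "\<alpha> \<notin> fst l2" using l2 by auto
  then have "is_lta_g m (h \<union> {\<alpha>, \<beta>}) b e"
    unfolding is_lta_g_def using lta assms by (auto simp: b_def e_def)
  then have orb: "act_poly b e {{\<alpha>, \<beta>}} \<in> orbit_g m (h \<union> {\<alpha>, \<beta>}) {{{\<alpha>, \<beta>}}}"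
    unfolding orbit_g_def by blast
  have "{{\<alpha>, \<beta>}} \<in> Rm m" using assms(1,2) by (simp add: Rm_def)
  then have Rm: "act_poly b e {{\<alpha>, \<beta>}} \<in> Rm m" using lta act_poly_Rm by blast
  have "insert \<alpha> {j. j < \<alpha> \<and> b \<alpha> j} = fst l1" "insert \<beta> {j. j < \<beta> \<and> b \<beta> j} = fst l2"
    using lt lt' l1 l2 by (auto simp: b_def)
  moreover have "e \<alpha> = snd l1" "e \<beta> = snd l2" using l2 by (auto simp: e_def)
  ultimately have "peval (act_poly b e {{\<alpha>, \<beta>}}) X \<longleftrightarrow> fapp l1 X \<and> fapp l2 X" for X
    using act_poly[of "{{\<alpha>, \<beta>}}" b e X] by (simp add: peval_singleton peval_lin_img fapp_def)
  then show ?thesis using orb Rm by blast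
qed

subsection \<open>Orbits\<close>

text \<open>Values determine the normal form, so P is the very set of monomials whose sum represents
  the codeword.\<close>

lemma code_subset:
  assumes "I \<subseteq> Pow {..<m}" "P \<in> Rm m" "ev m P \<in> code m I"
  shows "P \<subseteq> I"
proof -
  obtain J where J: "J \<subseteq> I" "ev m P = (\<lambda>X. X \<subseteq> {..<m} \<and> odd (card {f \<in> J. ev m {f} X}))"
    using assms(3) by (auto simp: code_def)
  have "peval P X \<longleftrightarrow> peval J X" if "X \<subseteq> {..<m}" for X
  proof -
    have "{f \<in> J. ev m {f} X} = {f \<in> J. f \<subseteq> X}" using that by (simp add: ev_def peval_singleton)
    then show ?thesis using fun_cong[OF J(2), of X] that by (simp add: ev_def peval_def)
  qed
  moreover have "J \<in> Rm m" using J(1) assms(1) by (auto simp: Rm_def)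
  ultimately have "P = J" using peval_ext[OF assms(2)] by blast
  then show ?thesis using J(1) by simp
qed

text \<open>The right-hand side is the second difference of p at the origin in the directions x and
  y.\<close>

lemma odd_card_Pow2:
  assumes "x \<noteq> y"
  shows "odd (card {Y \<in> Pow {x, y}. p Y}) \<longleftrightarrow> (p {} \<noteq> p {x}) \<noteq> (p {y} \<noteq> p {x, y})"
proof -
  have "{Y \<in> Pow {x, y}. p Y} = ((if p {} then {{}} else {}) \<triangle> (if p {x} then {{x}} else {})) \<triangle>
      ((if p {y} then {{y}} else {}) \<triangle> (if p {x, y} then {{x, y}} else {}))"
  proof (rule set_eqI)
    fix Y
    have "Y \<in> Pow {x, y} \<longleftrightarrow> Y = {} \<or> Y = {x} \<or> Y = {y} \<or> Y = {x, y}" by auto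
    moreover have "{x} \<noteq> {y}" "{x} \<noteq> {x, y}" "{y} \<noteq> {x, y}" using assms by auto
    ultimately show "Y \<in> {Y \<in> Pow {x, y}. p Y} \<longleftrightarrow>
      Y \<in> ((if p {} then {{}} else {}) \<triangle> (if p {x} then {{x}} else {})) \<triangle>
      ((if p {y} then {{y}} else {}) \<triangle> (if p {x, y} then {{x, y}} else {}))"
      by (auto split: if_splits)
  qed
  then show ?thesis by (simp add: even_card_sd)
qed

text \<open>By Moebius inversion the coefficient is the parity of the support points below
  \<open>h \<union> D\<close>. They lie on the flat and all pivots belong to h, so such points
  correspond to the choices of free coordinates inside D.\<close>

lemma coefficient_ech:
  assumes P: "P \<in> Rm m" and e: "echelon m h L" and D: "D \<subseteq> {..<m} - h"
    and S: "{X \<in> Pow {..<m}. peval P X} \<subseteq> ech m h L c"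
  shows "h \<union> D \<in> P \<longleftrightarrow> odd (card {Y \<in> Pow D. peval P (ext h L c Y)})"
proof -
  have hD: "h \<union> D \<subseteq> {..<m}" using e D by (auto simp: echelon_def)
  have ext: "ext h L c Y \<subseteq> h \<union> D" "ext h L c Y - h = Y" if "Y \<subseteq> D" for Y
    using that D by (auto simp: ext_def)
  have "bij_betw (ext h L c) {Y \<in> Pow D. peval P (ext h L c Y)} {X \<in> Pow (h \<union> D). peval P X}"
  proof (rule bij_betw_byWitness[where f' = "\<lambda>X. X - h"])
    show "\<forall>Y \<in> {Y \<in> Pow D. peval P (ext h L c Y)}. ext h L c Y - h = Y" using ext by blast
    show "ext h L c ` {Y \<in> Pow D. peval P (ext h L c Y)} \<subseteq> {X \<in> Pow (h \<union> D). peval P X}"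
      using ext(1) by blast
    have X: "ext h L c (X - h) = X" if "X \<subseteq> h \<union> D" "peval P X" for X
      using that S hD by (intro ext_ech[OF e]) blast
    then show "\<forall>X \<in> {X \<in> Pow (h \<union> D). peval P X}. ext h L c (X - h) = X" by simp
    show "(\<lambda>X. X - h) ` {X \<in> Pow (h \<union> D). peval P X} \<subseteq> {Y \<in> Pow D. peval P (ext h L c Y)}"
      using X by auto
  qed
  then have "card {Y \<in> Pow D. peval P (ext h L c Y)} = card {X \<in> Pow (h \<union> D). peval P X}"
    by (rule bij_betw_same_card)
  moreover have "finite P" "finite (h \<union> D)"
    using P hD by (auto simp: Rm_def intro: finite_family finite_subset)
  ultimately show ?thesis using moebius_inversion by simp
qed

theorem theorem4:
  fixes m r :: nat and I :: "mono set" and P :: bpoly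
  assumes "decreasing m I"
    and "I \<noteq> {}"
    and "r = Max (card ` I)"
    and "P \<in> Rm m"
    and "ev m P \<in> code m I"
    and "2 * weight m (ev m P) = 3 * wmin m r"
  shows "\<exists>f \<in> I. \<exists>g \<in> I. card f = r \<and> card g = r \<and>
           card (f \<inter> g) + 2 = r \<and>
           P \<in> orbit_g m (f \<inter> g)
                  (set_mul {{f \<inter> g}}
                     (set_add (orbit_g m f {{f - (f \<inter> g)}})
                              (orbit_g m g {{g - (f \<inter> g)}})))"
proof -
  have I: "I \<subseteq> Pow {..<m}" and dec: "\<And>f g. f \<in> I \<Longrightarrow> mono_le g f \<Longrightarrow> g \<in> I"
    using assms(1) by (auto simp: decreasing_def)
  have finI: "finite I" using I by (rule finite_family)
  have PI: "P \<subseteq> I" using code_subset[OF I assms(4,5)] .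
  have finP: "finite P" using PI finI finite_subset by blast
  have card_r: "card f \<le> r" if "f \<in> I" for f using that finI assms(3) by simp
  have "r \<in> card ` I" using assms(2,3) finI by simp
  \<comment> \<open>Guards the truncated subtraction in \<open>wmin\<close>.\<close>
  then have "r \<le> m" using I card_mono[of "{..<m}"] by force
  define S where "S = {X \<in> Pow {..<m}. peval P X}"
  have "weight m (ev m P) = card S"
    unfolding weight_def S_def ev_def by (rule arg_cong[where f = card]) auto
  then have "2 * (2 ^ r * card S) = 2 ^ r * (3 * 2 ^ (m - r))"
    using assms(6) by (simp add: wmin_def mult.left_commute)
  also have "\<dots> = 3 * (2 ^ r * 2 ^ (m - r))" by simp
  finally have w: "2 * (2 ^ r * card S) = 3 * 2 ^ m" using \<open>r \<le> m\<close> by (simp flip: power_add)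
  have "degle m r S"
    unfolding S_def using PI I card_r by (intro degle_peval[OF finP]) blast
  from three_halves_hyperbolic[OF this w] obtain h L c k1 k2 k3 k4 where
    e: "echelon m h L" and h: "card h + 2 = r" and ST: "S \<subseteq> ech m h L c"
    and "hyperbolic ({..<m} - h) (\<lambda>Y. ext h L c Y \<in> S) k1 k2 k3 k4"
    by (elim exE conjE)
  from hyperbolic_normal_form[OF this(4)] obtain l1 l2 l3 l4 \<alpha> \<beta> \<gamma> \<delta> where
    hyp: "hyperbolic ({..<m} - h) (\<lambda>Y. ext h L c Y \<in> S) l1 l2 l3 l4"
    and l1: "\<alpha> \<in> fst l1" "fst l1 \<subseteq> {..\<alpha>}" "\<beta> \<notin> fst l1"
    and l2: "\<beta> < \<alpha>" "\<beta> \<in> fst l2" "fst l2 \<subseteq> {..\<beta>}"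
    and l3: "\<gamma> \<in> fst l3" "fst l3 \<subseteq> {..\<gamma>}" "\<delta> \<notin> fst l3"
    and l4: "\<delta> < \<gamma>" "\<delta> \<in> fst l4" "fst l4 \<subseteq> {..\<delta>}"
    and dis: "\<alpha> \<notin> fst l3" "\<alpha> \<notin> fst l4" "\<beta> \<notin> fst l3" "\<beta> \<notin> fst l4"
    by (elim exE conjE)
  let ?K = "{..<m} - h"
  note K = hyperbolicD(2-5)[OF hyp]
  have in_K: "\<alpha> \<in> ?K" "\<beta> \<in> ?K" "\<gamma> \<in> ?K" "\<delta> \<in> ?K" using K l1 l2 l3 l4 by blast+
  have ne: "\<alpha> \<noteq> \<gamma>" "\<alpha> \<noteq> \<delta>" "\<beta> \<noteq> \<gamma>" "\<beta> \<noteq> \<delta>" using dis l3 l4 by auto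
  have finh: "finite h" and hm: "h \<subseteq> {..<m}" using echelon_finite[OF e] e by (auto simp: echelon_def)
  define f where "f = h \<union> {\<alpha>, \<beta>}"
  define g where "g = h \<union> {\<gamma>, \<delta>}"
  have fg: "f \<inter> g = h" and fh: "f - h = {\<alpha>, \<beta>}" and gh: "g - h = {\<gamma>, \<delta>}"
    using in_K ne by (auto simp: f_def g_def)
  have cards: "card f = r" "card g = r"
    using h in_K finh l2(1) l4(1) unfolding f_def g_def by auto

  have peval_ext_iff: "peval P (ext h L c Y) \<longleftrightarrow> (fapp l1 Y \<and> fapp l2 Y) \<noteq> (fapp l3 Y \<and> fapp l4 Y)"
    if "Y \<subseteq> ?K" for Y
  proof -
    have "ext h L c Y \<subseteq> {..<m}" using ext_in_ech[OF e that] by (auto simp: ech_def)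
    then show ?thesis using hyperbolicD(6)[OF hyp that] by (simp add: S_def)
  qed
  have fapp_simps: "fapp l {} \<longleftrightarrow> snd l" "fapp l {x} \<longleftrightarrow> (x \<in> fst l) \<noteq> snd l"
    "x \<noteq> y \<Longrightarrow> fapp l {x, y} \<longleftrightarrow> ((x \<in> fst l) \<noteq> (y \<in> fst l)) \<noteq> snd l" for l x y
    by (auto simp: fapp_def aff_def Int_insert_right)
  have coeff: "h \<union> {x, y} \<in> P \<longleftrightarrow>
      (peval P (ext h L c {}) \<noteq> peval P (ext h L c {x})) \<noteq> (peval P (ext h L c {y}) \<noteq> peval P (ext h L c {x, y}))"
    if "x \<in> ?K" "y \<in> ?K" "x \<noteq> y" for x y
    using coefficient_ech[OF assms(4) e, of "{x, y}" c] ST that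
      odd_card_Pow2[OF that(3), of "\<lambda>Y. peval P (ext h L c Y)"] by (simp add: S_def)

  \<comment> \<open>The second difference of l1 l2 in the directions \<alpha>, \<beta> is 1, as each
    variable occurs in exactly its own form. That of l3 l4 is 0, as neither occurs there. So f has
    coefficient 1.\<close>
  have "\<alpha> \<notin> fst l2" using l2 by auto
  then have "f \<in> P"
    unfolding f_def using coeff[of \<alpha> \<beta>] in_K l1 l2 dis
    by (auto simp: peval_ext_iff fapp_simps)
  then have fI: "f \<in> I" using PI by blast
  have "\<gamma> \<notin> fst l4" using l4 by auto
  \<comment> \<open>l3 l4 contributes 1 to the coefficient of g. If g is absent, l1 l2 cancels it,
    so \<gamma> and \<delta> can be matched to different forms of the first pair. The leading
    variables \<alpha> and \<beta> then bound them.\<close>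
  have gI: "g \<in> I"
  proof (cases "g \<in> P")
    case False
    then have "(\<gamma> \<in> fst l1 \<and> \<delta> \<in> fst l2) \<noteq> (\<delta> \<in> fst l1 \<and> \<gamma> \<in> fst l2)"
      unfolding g_def using coeff[of \<gamma> \<delta>] in_K l3 l4 \<open>\<gamma> \<notin> fst l4\<close>
      by (auto simp: peval_ext_iff fapp_simps)
    then have "\<gamma> \<le> \<alpha> \<and> \<delta> \<le> \<beta> \<or> \<delta> \<le> \<alpha> \<and> \<gamma> \<le> \<beta>" using l1 l2 by blast
    then show ?thesis
    proof (elim disjE conjE)
      assume le: "\<gamma> \<le> \<alpha>" "\<delta> \<le> \<beta>"
      \<comment> \<open>One variable is exchanged at a time, passing through the monomial of
        \<open>h \<union> {\<beta>, \<gamma>}\<close>.\<close>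
      have "mono_le (insert \<gamma> (insert \<beta> h)) (insert \<alpha> (insert \<beta> h))"
        using le(1) finh in_K ne l2(1) by (intro mono_le_replace) auto
      then have "insert \<beta> (insert \<gamma> h) \<in> I" using dec fI by (simp add: f_def insert_commute)
      moreover have "mono_le (insert \<delta> (insert \<gamma> h)) (insert \<beta> (insert \<gamma> h))"
        using le(2) finh in_K ne l4(1) by (intro mono_le_replace) auto
      ultimately show ?thesis using dec by (simp add: g_def insert_commute)
    next
      assume le: "\<delta> \<le> \<alpha>" "\<gamma> \<le> \<beta>"
      have "mono_le (insert \<delta> (insert \<beta> h)) (insert \<alpha> (insert \<beta> h))"
        using le(1) finh in_K ne l2(1) by (intro mono_le_replace) auto
      then have "insert \<beta> (insert \<delta> h) \<in> I" using dec fI by (simp add: f_def insert_commute)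
      moreover have "mono_le (insert \<gamma> (insert \<delta> h)) (insert \<beta> (insert \<delta> h))"
        using le(2) finh in_K ne l4(1) by (intro mono_le_replace) auto
      ultimately show ?thesis using dec by (simp add: g_def insert_commute)
    qed
  qed (use PI in blast)

  obtain Q1 where Q1: "Q1 \<in> orbit_g m f {{{\<alpha>, \<beta>}}}" "Q1 \<in> Rm m"
      "\<And>X. peval Q1 X \<longleftrightarrow> fapp l1 X \<and> fapp l2 X"
    using monomial_pair_orbit[of \<alpha> m \<beta> h l1 l2] in_K K hm l1 l2 unfolding f_def by blast
  obtain Q2 where Q2: "Q2 \<in> orbit_g m g {{{\<gamma>, \<delta>}}}" "Q2 \<in> Rm m"
      "\<And>X. peval Q2 X \<longleftrightarrow> fapp l3 X \<and> fapp l4 X"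
    using monomial_pair_orbit[of \<gamma> m \<delta> h l3 l4] in_K K hm l3 l4 unfolding g_def by blast
  define Q where "Q = pmul {h} (padd Q1 Q2)"
  have finQ: "finite Q1" "finite Q2" using Q1(2) Q2(2) by (auto simp: Rm_def intro: finite_family)
  have "padd Q1 Q2 \<subseteq> Pow {..<m}" using Q1(2) Q2(2) unfolding padd_eq Rm_def by (intro sd_subset) auto
  then have QRm: "Q \<in> Rm m" unfolding Q_def Rm_def using hm pmul_subset[of "{h}" "{..<m}"] by simp
  have peval_Q: "peval Q X \<longleftrightarrow> h \<subseteq> X \<and> (fapp l1 X \<and> fapp l2 X) \<noteq> (fapp l3 X \<and> fapp l4 X)" for X
    unfolding Q_def padd_eq using finQ by (simp add: peval_pmul peval_singleton peval_sd Q1(3) Q2(3))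
  have Q_in: "Q \<in> set_mul {{h}} (set_add (orbit_g m f {{f - h}}) (orbit_g m g {{g - h}}))"
    unfolding Q_def set_mul_def set_add_def fh gh using Q1(1) Q2(1) by blast

  define b where "b i j \<longleftrightarrow> i \<in> h \<and> j \<in> L i" for i j
  \<comment> \<open>With the constant c_i + 1 the image of x_i is 1 exactly where the pivot equation
    holds, so the monomial h becomes the indicator of the flat.\<close>
  define \<epsilon> where "\<epsilon> i \<longleftrightarrow> i \<in> h \<and> \<not> c i" for i
  have lta: "is_lta m b \<epsilon>" and lta_h: "is_lta_g m h b \<epsilon>"
    using echelonD[OF e] unfolding is_lta_g_def is_lta_def b_def \<epsilon>_def by blast+
  have "P = act_poly b \<epsilon> Q"
  proof (rule peval_ext[OF assms(4) act_poly_Rm[OF QRm lta]])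
    fix X assume X: "X \<subseteq> {..<m}"
    \<comment> \<open>The image point of X. It agrees with X off h, so the four forms take the same
      values at both, while \<open>h \<subseteq> Y\<close> says that X satisfies all pivot
      equations.\<close>
    define Y where "Y = {i. peval (lin_img b \<epsilon> i) X}"
    have Y_h: "i \<in> Y \<longleftrightarrow> (i \<in> X \<longleftrightarrow> aff (L i) (c i) X)" if "i \<in> h" for i
    proof -
      have "i \<notin> L i" using echelonD(2)[OF e that, of i] by blast
      then have "insert i {j. j < i \<and> b i j} = {i} \<triangle> L i"
        using echelonD(2)[OF e that] that by (auto simp: b_def)
      then show ?thesis
        using aff_sd[of "{i}" "L i" False "\<not> c i" X] echelon_finite(2)[OF e that] that
        by (simp add: Y_def peval_lin_img \<epsilon>_def aff_singleton aff_Not)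
    qed
    have "i \<in> Y \<longleftrightarrow> i \<in> X" if "i \<notin> h" for i
      using that aff_singleton[of i X] by (simp add: Y_def peval_lin_img b_def \<epsilon>_def)
    then have fapp_Y: "fapp l Y \<longleftrightarrow> fapp l (X - h)" if "fst l \<subseteq> ?K" for l
      unfolding fapp_def using that by (intro aff_cong) blast
    have "peval (act_poly b \<epsilon> Q) X \<longleftrightarrow> peval Q Y"
      using act_poly[of Q b \<epsilon> X] QRm unfolding Y_def Rm_def
      by (auto intro: finite_family finite_subset)
    also have "\<dots> \<longleftrightarrow> X \<in> ech m h L c \<and>
        (fapp l1 (X - h) \<and> fapp l2 (X - h)) \<noteq> (fapp l3 (X - h) \<and> fapp l4 (X - h))"
      unfolding peval_Q fapp_Y[OF K(1)] fapp_Y[OF K(2)] fapp_Y[OF K(3)] fapp_Y[OF K(4)]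
      using Y_h X by (auto simp: ech_def)
    also have "\<dots> \<longleftrightarrow> peval P X"
    proof (cases "X \<in> ech m h L c")
      case True
      then show ?thesis using peval_ext_iff[OF ech_Diff_subset[OF True]] ext_ech[OF e True] by simp
    next
      case False
      then show ?thesis using ST X unfolding S_def by blast
    qed
    finally show "peval P X \<longleftrightarrow> peval (act_poly b \<epsilon> Q) X" by simp
  qed
  then have "P \<in> orbit_g m h (set_mul {{h}} (set_add (orbit_g m f {{f - h}}) (orbit_g m g {{g - h}})))"
    using Q_in lta_h unfolding orbit_g_def by blast
  then show ?thesis using fI gI cards h fg by auto
qed

end
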